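(* Let $S$ be a (not necessarily commutative) local ring with involution $*$ and Jacobson radical $\mathfrak j$, let $\overline S=S/\mathfrak j$, let $m\ge 1$, and let $A=M(m,S)$ with the involution $(x^* )_{ij}=(x_{ji})^*$. If $|\overline S|>3$ and $2\in S^\times$, then the group homomorphism $\theta:H(A)\to SL_*(2,A)$ determined by $z\mapsto w$, $k_t\mapsto h_t$ ($t\in A^\times$), $v_r\mapsto u_r$ ($r\in A^s$) is an isomorphism.
   Context: An involution of a ring is an anti-automorphism $*$ with $x^{**}=x$. $A^\times$ is the unit group of $A$ and $A^s=\{r\in A: r^*=r\}$. For a $2\times 2$ matrix $x$ over $A$, $x^*$ is defined by $(x^* )_{ij}=(x_{ji})^*$. With $J=\begin{pmatrix}0&1\\-1&0\end{pmatrix}\in M(2,A)$, set $SL_*(2,A)=\{x\in \mathrm{GL}(2,A): x^*Jx=J\}$ (this is isomorphic to the rank $2m$ unitary group $U(2m,S)$ of the standard skew hermitian form). The Bruhat elements of $SL_*(2,A)$ are $w=\begin{pmatrix}0&1\\-1&0\end{pmatrix}$, $h_t=\begin{pmatrix}t&0\\0&(t^* )^{-1}\end{pmatrix}$ for $t\in A^\times$, and $u_r=\begin{pmatrix}1&r\\0&1\end{pmatrix}$ for $r\in A^s$. $H(A)$ is the abstract group with generators $z$, $k_t$ ($t\in A^\times$), $v_r$ ($r\in A^s$) and defining relations $$k_sk_t=k_{st},\quad v_qv_r=v_{q+r},\quad z^2=k_{-1},\quad k_tv_r=v_{trt^*}k_t,\quad zk_t=k_{(t^* )^{-1}}z\qquad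 (s,t\in A^\times,\ q,r\in A^s),$$ $$v_t z v_{t^{-1}} z v_t = z k_{-t^{-1}}\qquad (t\in A^\times\cap A^s).$$ The Bruhat elements satisfy the corresponding relations in $SL_*(2,A)$, so $\theta$ is a well-defined homomorphism. *)

theory Defs
  imports "HOL-Analysis.Analysis" "HOL-Algebra.Group"
begin

section \<open>Rings with involution, local rings\<close>

text \<open>Rings are types of class \<^class>\<open>ring_1\<close>; they need not be commutative. The multiplicative
  monoid of such a type is packaged as a record in order to use \<^const>\<open>Units\<close> and
  \<^const>\<open>m_inv\<close> from the algebra library.\<close>

definition mult_monoid :: "'a::monoid_mult monoid" where
  "mult_monoid = \<lparr>carrier = UNIV, monoid.mult = (*), one = 1\<rparr>"

abbreviation unit_set :: "'a::monoid_mult set" where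
  "unit_set \<equiv> Units mult_monoid"

abbreviation unit_inv :: "'a::monoid_mult \<Rightarrow> 'a" where
  "unit_inv t \<equiv> m_inv mult_monoid t"

lemma mult_monoid_simps [simp]:
  "carrier (mult_monoid :: 'a::monoid_mult monoid) = UNIV"
  "monoid.mult (mult_monoid :: 'a monoid) = (*)"
  "one (mult_monoid :: 'a monoid) = 1"
  by (simp_all add: mult_monoid_def)

lemma monoid_mult_monoid: "Group.monoid (mult_monoid :: 'a::monoid_mult monoid)"
  by unfold_locales (simp_all add: mult.assoc)

lemma unit_set_iff: "(t :: 'a::monoid_mult) \<in> unit_set \<longleftrightarrow> (\<exists>s. s * t = 1 \<and> t * s = 1)"
  by (simp add: Units_def)

definition ring_involution :: "('a::ring_1 \<Rightarrow> 'a) \<Rightarrow> bool" where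
  "ring_involution star \<longleftrightarrow>
     (\<forall>x y. star (x + y) = star x + star y) \<and>
     (\<forall>x y. star (x * y) = star y * star x) \<and>
     star 1 = 1 \<and>
     (\<forall>x. star (star x) = x)"

definition symmetric_elements :: "('a \<Rightarrow> 'a) \<Rightarrow> 'a set" where
  "symmetric_elements star = {r. star r = r}"

definition left_ideal :: "'a::ring_1 set \<Rightarrow> bool" where
  "left_ideal I \<longleftrightarrow> 0 \<in> I \<and> (\<forall>x\<in>I. \<forall>y\<in>I. x + y \<in> I) \<and> (\<forall>a. \<forall>x\<in>I. a * x \<in> I)"

definition maximal_left_ideal :: "'a::ring_1 set \<Rightarrow> bool" where
  "maximal_left_ideal I \<longleftrightarrow>
     left_ideal I \<and> I \<noteq> UNIV \<and> (\<forall>I'. left_ideal I' \<and> I \<subseteq> I' \<longrightarrow> I' = I \<or> I' = UNIV)"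

definition local_ring :: "'a::ring_1 itself \<Rightarrow> bool" where
  "local_ring _ \<longleftrightarrow> (\<exists>!I :: 'a set. maximal_left_ideal I)"

definition jacobson_radical :: "'a::ring_1 set" where
  "jacobson_radical = \<Inter>{I. maximal_left_ideal I}"

text \<open>The underlying set of the quotient of the ring by its Jacobson radical.\<close>

definition radical_quotient :: "'a::ring_1 set set" where
  "radical_quotient = UNIV // {(x, y). x - y \<in> jacobson_radical}"


section \<open>Rings of square matrices\<close>

text \<open>The product on the type \<open>'a ^ 'n ^ 'n\<close> itself is componentwise, so the matrix ring
  \<open>M(n, R)\<close> is a separate copy of that type, with \<^const>\<open>matrix_matrix_mult\<close> as its product.
  The construction can be iterated: \<open>M(2, M(m, S))\<close> is \<open>(('s, 'm) sqmat, 2) sqmat\<close>.\<close>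

typedef ('a, 'n) sqmat = "UNIV :: ('a ^ 'n ^ 'n) set"
  morphisms entries of_entries by simp

lemma entries_of_entries [simp]: "entries (of_entries X) = X"
  by (simp add: of_entries_inverse)

lemma sqmat_eq_iff: "x = y \<longleftrightarrow> entries x = entries y"
  by (simp add: entries_inject)

instantiation sqmat :: (ring_1, finite) ring_1
begin

definition zero_sqmat :: "('a, 'b) sqmat" where "0 = of_entries 0"
definition one_sqmat :: "('a, 'b) sqmat" where "1 = of_entries (mat 1)"
definition plus_sqmat :: "('a, 'b) sqmat \<Rightarrow> _" where
  "x + y = of_entries (entries x + entries y)"
definition minus_sqmat :: "('a, 'b) sqmat \<Rightarrow> _" where
  "x - y = of_entries (entries x - entries y)"
definition uminus_sqmat :: "('a, 'b) sqmat \<Rightarrow> _" where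
  "- x = of_entries (- entries x)"
definition times_sqmat :: "('a, 'b) sqmat \<Rightarrow> _" where
  "x * y = of_entries (entries x ** entries y)"

lemma entries_simps [simp]:
  "entries (0 :: ('a, 'b) sqmat) = 0"
  "entries (1 :: ('a, 'b) sqmat) = mat 1"
  "entries (x + y :: ('a, 'b) sqmat) = entries x + entries y"
  "entries (x - y :: ('a, 'b) sqmat) = entries x - entries y"
  "entries (- x :: ('a, 'b) sqmat) = - entries x"
  "entries (x * y :: ('a, 'b) sqmat) = entries x ** entries y"
  by (simp_all add: zero_sqmat_def one_sqmat_def plus_sqmat_def minus_sqmat_def
      uminus_sqmat_def times_sqmat_def)

instance
proof
  fix a b c :: "('a, 'b) sqmat"
  show "a * b * c = a * (b * c)" by (simp add: sqmat_eq_iff matrix_mul_assoc)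
  show "(a + b) * c = a * c + b * c"
    by (simp add: sqmat_eq_iff vec_eq_iff matrix_matrix_mult_def distrib_right sum.distrib)
  show "a * (b + c) = a * b + a * c"
    by (simp add: sqmat_eq_iff vec_eq_iff matrix_matrix_mult_def distrib_left sum.distrib)
  show "(0 :: ('a, 'b) sqmat) \<noteq> 1"
    by (simp add: sqmat_eq_iff vec_eq_iff mat_def)
qed (simp_all add: sqmat_eq_iff ac_simps)

end

definition star_transpose :: "('a \<Rightarrow> 'a) \<Rightarrow> ('a, 'n::finite) sqmat \<Rightarrow> ('a, 'n) sqmat" where
  "star_transpose star x = of_entries (\<chi> i j. star (entries x $ j $ i))"

definition mat2 :: "'a::ring_1 \<Rightarrow> 'a \<Rightarrow> 'a \<Rightarrow> 'a \<Rightarrow> ('a, 2) sqmat" where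
  "mat2 a b c d = of_entries (vector [vector [a, b], vector [c, d]])"

lemma ring_involution_star_transpose:
  assumes "ring_involution star"
  shows "ring_involution (star_transpose star :: ('a::ring_1, 'n::finite) sqmat \<Rightarrow> _)"
proof -
  note s = assms[unfolded ring_involution_def]
  have z: "star 0 = 0" using s by (metis add_cancel_right_left)
  have sm: "star (sum f A) = (\<Sum>i\<in>A. star (f i))" if "finite A" for f :: "'n \<Rightarrow> 'a" and A
    using that by (induction A rule: finite_induct) (use s z in auto)
  show ?thesis
    unfolding ring_involution_def
    using s z sm by (auto simp: star_transpose_def sqmat_eq_iff vec_eq_iff
        matrix_matrix_mult_def mat_def)
qed


section \<open>The group \<open>SL_*(2, A)\<close> and its Bruhat elements\<close>

definition J_mat :: "('a::ring_1, 2) sqmat" where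
  "J_mat = mat2 0 1 (- 1) 0"

definition SL_star :: "('a::ring_1 \<Rightarrow> 'a) \<Rightarrow> ('a, 2) sqmat monoid" where
  "SL_star star =
     mult_monoid\<lparr>carrier := {x \<in> unit_set. star_transpose star x * J_mat * x = J_mat}\<rparr>"

lemma group_SL_star:
  assumes "ring_involution star"
  shows "group (SL_star star)"
proof -
  let ?s = "star_transpose star :: ('a, 2) sqmat \<Rightarrow> _"
  interpret M: Group.monoid "mult_monoid :: ('a, 2) sqmat monoid"
    by (rule monoid_mult_monoid)
  have inv: "ring_involution ?s"
    using assms by (rule ring_involution_star_transpose)
  have s1: "?s 1 = 1" and sm: "\<And>x y. ?s (x * y) = ?s y * ?s x"
    using inv by (auto simp: ring_involution_def)
  show ?thesis
  proof (rule groupI)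
    fix x y
    assume "x \<in> carrier (SL_star star)" "y \<in> carrier (SL_star star)"
    then have x: "x \<in> unit_set" "?s x * J_mat * x = J_mat"
      and y: "y \<in> unit_set" "?s y * J_mat * y = J_mat"
      by (auto simp: SL_star_def)
    have "?s (x * y) * J_mat * (x * y) = ?s y * (?s x * J_mat * x) * y"
      by (simp add: sm mult.assoc)
    then show "x \<otimes>\<^bsub>SL_star star\<^esub> y \<in> carrier (SL_star star)"
      using x y M.Units_m_closed[of x y] by (simp add: SL_star_def)
  next
    fix x
    assume "x \<in> carrier (SL_star star)"
    then have x: "x \<in> unit_set" "?s x * J_mat * x = J_mat"
      by (auto simp: SL_star_def)
    then obtain y where y: "y * x = 1" "x * y = 1"
      by (auto simp: unit_set_iff)
    have "?s y * J_mat * y = ?s y * (?s x * J_mat * x) * y"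
      by (simp add: x)
    also have "\<dots> = ?s (x * y) * J_mat * (x * y)"
      by (simp add: sm mult.assoc)
    finally have "?s y * J_mat * y = J_mat"
      by (simp add: y s1)
    moreover have "y \<in> unit_set"
      using y by (auto simp: unit_set_iff)
    ultimately show "\<exists>y\<in>carrier (SL_star star). y \<otimes>\<^bsub>SL_star star\<^esub> x = \<one>\<^bsub>SL_star star\<^esub>"
      using y by (auto simp: SL_star_def)
  qed (auto simp: SL_star_def mult.assoc s1 unit_set_iff)
qed

definition bruhat_w :: "('a::ring_1, 2) sqmat" where
  "bruhat_w = mat2 0 1 (- 1) 0"

definition bruhat_h :: "('a::ring_1 \<Rightarrow> 'a) \<Rightarrow> 'a \<Rightarrow> ('a, 2) sqmat" where
  "bruhat_h star t = mat2 t 0 0 (unit_inv (star t))"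

definition bruhat_u :: "'a::ring_1 \<Rightarrow> ('a, 2) sqmat" where
  "bruhat_u r = mat2 1 r 0 1"


section \<open>Groups given by generators and relations\<close>

text \<open>A word is a list of letters \<open>(x, e)\<close>, where \<open>e\<close> tells whether the letter stands for the
  inverse of the generator \<open>x\<close>. A relation \<open>u = v\<close> is a pair of words. The presented group
  consists of the classes of words modulo the least congruence that contains the relations and
  the free cancellations.\<close>

type_synonym 'x word = "('x \<times> bool) list"

definition words :: "'x set \<Rightarrow> 'x word set" where
  "words X = lists (X \<times> UNIV)"

inductive pres_eq :: "'x set \<Rightarrow> ('x word \<times> 'x word) set \<Rightarrow> 'x word \<Rightarrow> 'x word \<Rightarrow> bool"
  for X R where
  refl: "u \<in> words X \<Longrightarrow> pres_eq X R u u"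
| sym: "pres_eq X R u v \<Longrightarrow> pres_eq X R v u"
| trans: "pres_eq X R u v \<Longrightarrow> pres_eq X R v w \<Longrightarrow> pres_eq X R u w"
| append: "pres_eq X R u u' \<Longrightarrow> pres_eq X R v v' \<Longrightarrow> pres_eq X R (u @ v) (u' @ v')"
| cancel: "x \<in> X \<Longrightarrow> pres_eq X R [(x, e), (x, \<not> e)] []"
| rel: "(u, v) \<in> R \<Longrightarrow> u \<in> words X \<Longrightarrow> v \<in> words X \<Longrightarrow> pres_eq X R u v"

definition word_class :: "'x set \<Rightarrow> ('x word \<times> 'x word) set \<Rightarrow> 'x word \<Rightarrow> 'x word set" where
  "word_class X R u = {v. pres_eq X R u v}"

definition presented_group :: "'x set \<Rightarrow> ('x word \<times> 'x word) set \<Rightarrow> 'x word set monoid" where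
  "presented_group X R =
     \<lparr>carrier = word_class X R ` words X,
      monoid.mult = (\<lambda>C D. \<Union>u\<in>C. \<Union>v\<in>D. word_class X R (u @ v)),
      one = word_class X R []\<rparr>"

definition gen_class :: "'x set \<Rightarrow> ('x word \<times> 'x word) set \<Rightarrow> 'x \<Rightarrow> 'x word set" where
  "gen_class X R x = word_class X R [(x, False)]"

lemma pres_eq_words: "pres_eq X R u v \<Longrightarrow> u \<in> words X \<and> v \<in> words X"
  by (induction rule: pres_eq.induct) (auto simp: words_def)

lemma word_class_eq: "pres_eq X R u v \<Longrightarrow> word_class X R u = word_class X R v"
  unfolding word_class_def by (blast intro: pres_eq.sym pres_eq.trans)

lemma presented_group_mult:
  assumes "u \<in> words X" "v \<in> words X"
  shows "word_class X R u \<otimes>\<^bsub>presented_group X R\<^esub> word_class X R v = word_class X R (u @ v)"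
proof -
  have *: "word_class X R (u' @ v') = word_class X R (u @ v)"
    if "u' \<in> word_class X R u" "v' \<in> word_class X R v" for u' v'
  proof -
    have "pres_eq X R u u'" "pres_eq X R v v'"
      using that by (simp_all add: word_class_def)
    then have "pres_eq X R (u @ v) (u' @ v')" by (rule pres_eq.append)
    then show ?thesis by (rule word_class_eq[symmetric])
  qed
  have "u \<in> word_class X R u" "v \<in> word_class X R v"
    using assms by (auto simp: word_class_def intro: pres_eq.refl)
  then have "(\<Union>u'\<in>word_class X R u. \<Union>v'\<in>word_class X R v. word_class X R (u' @ v')) =
      word_class X R (u @ v)"
    using * by blast
  then show ?thesis
    by (simp add: presented_group_def)
qed

lemma group_presented_group: "group (presented_group X R)"
proof (rule groupI)
  show "\<one>\<^bsub>presented_group X R\<^esub> \<in> carrier (presented_group X R)"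
    by (auto simp: presented_group_def words_def)
next
  fix C D
  assume "C \<in> carrier (presented_group X R)" "D \<in> carrier (presented_group X R)"
  then obtain u v where uv: "u \<in> words X" "v \<in> words X"
    "C = word_class X R u" "D = word_class X R v"
    by (auto simp: presented_group_def)
  then have "u @ v \<in> words X" by (auto simp: words_def)
  then show "C \<otimes>\<^bsub>presented_group X R\<^esub> D \<in> carrier (presented_group X R)"
    unfolding uv(3,4) presented_group_mult[OF uv(1,2)] by (simp add: presented_group_def)
next
  fix C D E
  assume "C \<in> carrier (presented_group X R)" "D \<in> carrier (presented_group X R)"
    "E \<in> carrier (presented_group X R)"
  then obtain u v w where "u \<in> words X" "v \<in> words X" "w \<in> words X"
    "C = word_class X R u" "D = word_class X R v" "E = word_class X R w"
    by (auto simp: presented_group_def)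
  moreover from this have "u @ v \<in> words X" "v @ w \<in> words X" by (auto simp: words_def)
  ultimately show "C \<otimes>\<^bsub>presented_group X R\<^esub> D \<otimes>\<^bsub>presented_group X R\<^esub> E =
      C \<otimes>\<^bsub>presented_group X R\<^esub> (D \<otimes>\<^bsub>presented_group X R\<^esub> E)"
    by (simp add: presented_group_mult)
next
  fix C
  assume "C \<in> carrier (presented_group X R)"
  then obtain u where u: "u \<in> words X" "C = word_class X R u"
    by (auto simp: presented_group_def)
  have e: "[] \<in> words X" by (simp add: words_def)
  have one: "\<one>\<^bsub>presented_group X R\<^esub> = word_class X R []"
    by (simp add: presented_group_def)
  show "\<one>\<^bsub>presented_group X R\<^esub> \<otimes>\<^bsub>presented_group X R\<^esub> C = C"
    using presented_group_mult[OF e u(1)] by (simp add: one u)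
  have "\<exists>v\<in>words X. pres_eq X R (v @ u) []"
    using u(1)
  proof (induction u)
    case Nil
    then show ?case by (auto intro!: bexI[of _ "[]"] pres_eq.refl simp: words_def)
  next
    case (Cons l u)
    obtain x b where l: "l = (x, b)" by (cases l)
    from Cons obtain v where v: "v \<in> words X" "pres_eq X R (v @ u) []"
      by (auto simp: words_def)
    from Cons.prems l have x: "x \<in> X" and u: "u \<in> words X"
      by (auto simp: words_def)
    have c: "pres_eq X R [(x, \<not> b), (x, b)] []"
      using pres_eq.cancel[OF x, of R "\<not> b"] by simp
    have "pres_eq X R (v @ [(x, \<not> b), (x, b)] @ u) (v @ [] @ u)"
      by (intro pres_eq.append pres_eq.refl v u c)
    then have "pres_eq X R ((v @ [(x, \<not> b)]) @ l # u) []"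
      using pres_eq.trans[OF _ v(2)] l by simp
    moreover have "v @ [(x, \<not> b)] \<in> words X"
      using v(1) x by (auto simp: words_def)
    ultimately show ?case by blast
  qed
  then obtain v where v: "v \<in> words X" "pres_eq X R (v @ u) []" by blast
  have "word_class X R v \<in> carrier (presented_group X R)"
    using v(1) by (auto simp: presented_group_def)
  moreover have "word_class X R v \<otimes>\<^bsub>presented_group X R\<^esub> C = \<one>\<^bsub>presented_group X R\<^esub>"
    using v u by (simp add: presented_group_mult one word_class_eq)
  ultimately show "\<exists>D\<in>carrier (presented_group X R).
      D \<otimes>\<^bsub>presented_group X R\<^esub> C = \<one>\<^bsub>presented_group X R\<^esub>" by blast
qed


section \<open>The group \<open>H(A)\<close>\<close>

datatype 'a H_gen = Z | K 'a | V 'a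

definition H_gens :: "('a::ring_1 \<Rightarrow> 'a) \<Rightarrow> 'a H_gen set" where
  "H_gens star = {Z} \<union> K ` unit_set \<union> V ` symmetric_elements star"

abbreviation pos_word :: "'x list \<Rightarrow> 'x word" where
  "pos_word xs \<equiv> map (\<lambda>x. (x, False)) xs"

definition H_rels :: "('a::ring_1 \<Rightarrow> 'a) \<Rightarrow> ('a H_gen word \<times> 'a H_gen word) set" where
  "H_rels star =
     {(pos_word [K s, K t], pos_word [K (s * t)]) | s t. s \<in> unit_set \<and> t \<in> unit_set} \<union>
     {(pos_word [V q, V r], pos_word [V (q + r)]) | q r.
        q \<in> symmetric_elements star \<and> r \<in> symmetric_elements star} \<union>
     {(pos_word [Z, Z], pos_word [K (- 1)])} \<union>
     {(pos_word [K t, V r], pos_word [V (t * r * star t), K t]) | t r.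
        t \<in> unit_set \<and> r \<in> symmetric_elements star} \<union>
     {(pos_word [Z, K t], pos_word [K (unit_inv (star t)), Z]) | t. t \<in> unit_set} \<union>
     {(pos_word [V t, Z, V (unit_inv t), Z, V t], pos_word [Z, K (- unit_inv t)]) | t.
        t \<in> unit_set \<inter> symmetric_elements star}"

definition H_group :: "('a::ring_1 \<Rightarrow> 'a) \<Rightarrow> 'a H_gen word set monoid" where
  "H_group star = presented_group (H_gens star) (H_rels star)"

definition H_z :: "('a::ring_1 \<Rightarrow> 'a) \<Rightarrow> 'a H_gen word set" where
  "H_z star = gen_class (H_gens star) (H_rels star) Z"

definition H_k :: "('a::ring_1 \<Rightarrow> 'a) \<Rightarrow> 'a \<Rightarrow> 'a H_gen word set" where
  "H_k star t = gen_class (H_gens star) (H_rels star) (K t)"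

definition H_v :: "('a::ring_1 \<Rightarrow> 'a) \<Rightarrow> 'a \<Rightarrow> 'a H_gen word set" where
  "H_v star r = gen_class (H_gens star) (H_rels star) (V r)"

definition is_bruhat_hom ::
    "('a::ring_1 \<Rightarrow> 'a) \<Rightarrow> ('a H_gen word set \<Rightarrow> ('a, 2) sqmat) \<Rightarrow> bool" where
  "is_bruhat_hom star \<theta> \<longleftrightarrow>
     \<theta> \<in> hom (H_group star) (SL_star star) \<and>
     \<theta> (H_z star) = bruhat_w \<and>
     (\<forall>t\<in>unit_set. \<theta> (H_k star t) = bruhat_h star t) \<and>
     (\<forall>r\<in>symmetric_elements star. \<theta> (H_v star r) = bruhat_u r)"

end

theory Submission
  imports Defs "HOL-Algebra.Coset"
begin

text \<open>Put \<open>y r = z v\<^sub>r z\<inverse>\<close>; its image is the lower unipotent matrix with entry \<open>- r\<close>. Let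
  \<open>V\<close>, \<open>K\<close>, \<open>Y\<close> be the images of \<open>v\<close>, \<open>k\<close>, \<open>y\<close> in \<open>H(A)\<close>. The group \<open>K\<close> normalizes \<open>V\<close>
  and \<open>Y\<close>, and the last relation rewrites \<open>v\<^sub>s\<close> and \<open>y s\<close>, for a unit \<open>s\<close>, in terms of \<open>z\<close>.

  Injectivity. If the lower right entry \<open>1 - r s\<close> of the image of \<open>y r v\<^sub>s\<close> is a unit, then this
  image factors as upper unipotent times diagonal times lower unipotent. The heart of the matter is
  that the factorization lifts: \<open>y r v\<^sub>s\<close> lies in \<open>V K Y\<close>. Granted this, \<open>V K Y V\<close> is stable under
  right multiplication by the generators (\<open>VKYV_z\<close>), so it is the whole group, and matrix
  entries show that only the identity lies above the identity (\<open>VKYV_kernel\<close>).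

  For a unit \<open>s\<close> the lifting is a computation with the relations (\<open>yv_unit\<close>). In general one has to
  walk from \<open>0\<close> to \<open>s\<close> inside the set of symmetric \<open>q\<close> with \<open>1 - r q\<close> a unit. In geometric terms
  these \<open>q\<close> are the Lagrangians transversal to two given ones, and the steps permitted by the
  relations join transversal Lagrangians. The predicate \<open>linked\<close> records the walks, together with
  the symmetries that come from inversion and from conjugation by \<open>z\<close> and \<open>K\<close>. If \<open>r\<close> has rank
  one modulo the radical, a base change turns \<open>r\<close> into a matrix with one nonzero entry, and the
  intermediate points are found by adding diagonal matrices with entries in \<open>{0, 1, -1}\<close>
  (\<open>linked_rank_one\<close>). By symmetry, \<open>s\<close> of rank one is settled as well. A general \<open>s\<close> is peeled off
  by parts \<open>f = s v (v\<^sup>* s v)\<inverse> v\<^sup>* s\<close> of rank one (\<open>linked_all\<close>); by Wedderburn's rank reduction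
  \<open>s - f\<close> has smaller rank. The step to \<open>f\<close> is permitted if the hermitian forms \<open>s\<close> and \<open>s - s r s\<close>
  both take a unit value at \<open>v\<close>. That two nonzero hermitian forms over a division ring of
  characteristic other than two with more than three elements have a common nonzero value is
  \<open>common_form_value_unit\<close>; this is where the size of the residue ring enters.

  Surjectivity. If the lower left entry \<open>c\<close> of a matrix in \<open>SL\<^sub>*(2, A)\<close> is zero modulo the radical,
  the matrix factors directly. Otherwise multiplication by lower unipotent matrices lowers the rank
  of \<open>c\<close>, again by Wedderburn's rank reduction (\<open>SL_star_generated\<close>).\<close>

section \<open>Units and involutions\<close>

lemma unit_setI: "s * t = 1 \<Longrightarrow> t * s = 1 \<Longrightarrow> t \<in> unit_set"
  by (auto simp: unit_set_iff)

lemma unit_inv_left [simp]: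
  fixes t :: "'a::monoid_mult" shows "t \<in> unit_set \<Longrightarrow> unit_inv t * t = 1"
  using Group.monoid.Units_l_inv[OF monoid_mult_monoid, of t] by simp

lemma unit_inv_right [simp]:
  fixes t :: "'a::monoid_mult" shows "t \<in> unit_set \<Longrightarrow> t * unit_inv t = 1"
  using Group.monoid.Units_r_inv[OF monoid_mult_monoid, of t] by simp

lemma unit_inv_cancel_left [simp]:
  fixes t :: "'a::monoid_mult"
  shows "t \<in> unit_set \<Longrightarrow> unit_inv t * (t * x) = x" "t \<in> unit_set \<Longrightarrow> t * (unit_inv t * x) = x"
  by (simp_all add: mult.assoc [symmetric])

lemma unit_inv_unique:
  fixes t :: "'a::monoid_mult"
  assumes "s * t = 1" "t * s = 1" shows "unit_inv t = s"
  by (metis assms mult.assoc mult_1_left mult_1_right unit_inv_left unit_setI)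

lemma unit_left_inverse:
  fixes s t :: "'a::monoid_mult"
  assumes "t \<in> unit_set" "s * t = 1"
  shows "t * s = 1"
proof -
  have "s = (s * t) * unit_inv t" using assms(1) by (simp add: mult.assoc)
  then show ?thesis using assms by simp
qed

lemma unit_inv_closed [simp]:
  fixes t :: "'a::monoid_mult" shows "t \<in> unit_set \<Longrightarrow> unit_inv t \<in> unit_set"
  by (rule unit_setI[of t]) auto

lemma unit_one [simp]: "(1 :: 'a::monoid_mult) \<in> unit_set"
  by (rule unit_setI[of 1]) auto

lemma unit_mult [simp]:
  fixes s t :: "'a::monoid_mult"
  shows "s \<in> unit_set \<Longrightarrow> t \<in> unit_set \<Longrightarrow> s * t \<in> unit_set"
  by (rule unit_setI[of "unit_inv t * unit_inv s"]) (simp_all add: mult.assoc)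

lemma unit_inv_inv [simp]:
  fixes t :: "'a::monoid_mult" shows "t \<in> unit_set \<Longrightarrow> unit_inv (unit_inv t) = t"
  by (rule unit_inv_unique) auto

lemma unit_inv_one [simp]: "unit_inv (1 :: 'a::monoid_mult) = 1"
  by (rule unit_inv_unique) auto

lemma unit_inv_mult:
  fixes s t :: "'a::monoid_mult"
  shows "s \<in> unit_set \<Longrightarrow> t \<in> unit_set \<Longrightarrow> unit_inv (s * t) = unit_inv t * unit_inv s"
  by (rule unit_inv_unique) (simp_all add: mult.assoc)

lemma unit_uminus [simp]: "- (t :: 'a::ring_1) \<in> unit_set \<longleftrightarrow> t \<in> unit_set"
proof -
  have "- s \<in> unit_set" if "s \<in> unit_set" for s :: 'a
    using that by (intro unit_setI[of "- unit_inv s"]) auto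
  from this[of t] this[of "- t"] show ?thesis by auto
qed

lemma unit_diff_commute: "(s - t :: 'a::ring_1) \<in> unit_set \<longleftrightarrow> t - s \<in> unit_set"
  using unit_uminus[of "s - t"] by simp

lemma unit_inv_uminus: "(t :: 'a::ring_1) \<in> unit_set \<Longrightarrow> unit_inv (- t) = - unit_inv t"
  by (rule unit_inv_unique) auto

lemma unit_mult_cancel_left:
  fixes s t :: "'a::monoid_mult"
  assumes "s \<in> unit_set" "s * t \<in> unit_set" shows "t \<in> unit_set"
proof -
  have "unit_inv s * (s * t) \<in> unit_set"
    by (rule unit_mult[OF unit_inv_closed[OF assms(1)] assms(2)])
  moreover have "unit_inv s * (s * t) = t" using assms by simp
  ultimately show ?thesis by metis
qed

lemma unit_mult_cancel_right:
  fixes s t :: "'a::monoid_mult"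
  assumes "t \<in> unit_set" "s * t \<in> unit_set" shows "s \<in> unit_set"
proof -
  have "(s * t) * unit_inv t \<in> unit_set"
    by (rule unit_mult[OF assms(2) unit_inv_closed[OF assms(1)]])
  moreover have "(s * t) * unit_inv t = s" using assms by (simp add: mult.assoc)
  ultimately show ?thesis by metis
qed

locale involution =
  fixes star :: "'a::ring_1 \<Rightarrow> 'a"
  assumes ring_involution: "ring_involution star"
begin

abbreviation sym :: "'a set" where "sym \<equiv> symmetric_elements star"

lemma star_add [simp]: "star (x + y) = star x + star y"
  and star_mult [simp]: "star (x * y) = star y * star x"
  and star_one [simp]: "star 1 = 1"
  and star_star [simp]: "star (star x) = x"
  using ring_involution by (auto simp: ring_involution_def)

lemma star_zero [simp]: "star 0 = 0"
  using star_add[of 0 0] by simp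

lemma star_uminus [simp]: "star (- x) = - star x"
  using star_add[of x "- x"] by (simp add: minus_unique)

lemma star_diff [simp]: "star (x - y) = star x - star y"
  using star_add[of x "- y"] by simp

lemma star_sum: "star (sum f I) = (\<Sum>i\<in>I. star (f i))"
  by (induction I rule: infinite_finite_induct) auto

lemma star_unit [simp]: "star x \<in> unit_set \<longleftrightarrow> x \<in> unit_set"
proof -
  have "star y \<in> unit_set" if "y \<in> unit_set" for y
    using that by (intro unit_setI[of "star (unit_inv y)"]) (simp_all flip: star_mult)
  from this[of x] this[of "star x"] show ?thesis by auto
qed

lemma star_unit_inv: "x \<in> unit_set \<Longrightarrow> star (unit_inv x) = unit_inv (star x)"
  by (rule unit_inv_unique [symmetric]) (simp_all flip: star_mult)

lemma sym_iff: "r \<in> sym \<longleftrightarrow> star r = r"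
  by (simp add: symmetric_elements_def)

lemma sym_closed [simp]:
  "0 \<in> sym" "1 \<in> sym" "r \<in> sym \<Longrightarrow> - r \<in> sym"
  "r \<in> sym \<Longrightarrow> s \<in> sym \<Longrightarrow> r + s \<in> sym" "r \<in> sym \<Longrightarrow> s \<in> sym \<Longrightarrow> r - s \<in> sym"
  "r \<in> sym \<Longrightarrow> t * r * star t \<in> sym" "r \<in> sym \<Longrightarrow> star t * r * t \<in> sym"
  "r \<in> sym \<Longrightarrow> r \<in> unit_set \<Longrightarrow> unit_inv r \<in> sym"
  by (simp_all add: sym_iff star_unit_inv mult.assoc)

text \<open>The product of the lower unipotent matrix with entry \<open>- r\<close> and the upper unipotent one
  with entry \<open>s\<close> has lower row \<open>(- r, 1 - r s)\<close>. Once \<open>1 - r s\<close> is a unit, this row is a left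
  multiple of that of the lower unipotent matrix with parameter \<open>(1 - r s)\<inverse> r\<close>. The parameter
  is symmetric because \<open>(1 - r s) r = r (1 - s r)\<close>.\<close>

lemma sym_move:
  assumes "r \<in> sym" "s \<in> sym" "1 - r * s \<in> unit_set"
  shows "unit_inv (1 - r * s) * r \<in> sym"
proof -
  let ?d = "1 - r * s"
  have sd: "star ?d = 1 - s * r" using assms by (simp add: sym_iff)
  have u: "1 - s * r \<in> unit_set" using assms(3) sd star_unit[of ?d] by metis
  have "?d * r = r * (1 - s * r)" by (simp add: algebra_simps)
  then have "unit_inv ?d * (?d * r) * unit_inv (1 - s * r) = 
     unit_inv ?d * (r * (1 - s * r)) * unit_inv (1 - s * r)" by simp
  then have "r * unit_inv (1 - s * r) = unit_inv ?d * r"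
    using assms(3) u by (simp add: mult.assoc)
  then show ?thesis
    using assms by (simp add: sym_iff star_unit_inv)
qed

end

section \<open>Groups given by generators and relations\<close>

primrec word_value :: "('g, 'b) monoid_scheme \<Rightarrow> ('x \<Rightarrow> 'g) \<Rightarrow> 'x word \<Rightarrow> 'g" where
  "word_value M f [] = \<one>\<^bsub>M\<^esub>"
| "word_value M f (l # u) =
     (if snd l then inv\<^bsub>M\<^esub> (f (fst l)) else f (fst l)) \<otimes>\<^bsub>M\<^esub> word_value M f u"

lemma words_simps [simp]:
  "[] \<in> words X" "l # u \<in> words X \<longleftrightarrow> fst l \<in> X \<and> u \<in> words X"
  "u @ v \<in> words X \<longleftrightarrow> u \<in> words X \<and> v \<in> words X"
  by (auto simp: words_def mem_Times_iff)

context group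
begin

lemma word_value_closed:
  assumes "f \<in> X \<rightarrow> carrier G" "u \<in> words X"
  shows "word_value G f u \<in> carrier G"
  using assms(2) assms(1) by (induction u) (auto simp: Pi_iff)

lemma word_value_append:
  assumes "f \<in> X \<rightarrow> carrier G" "u \<in> words X" "v \<in> words X"
  shows "word_value G f (u @ v) = word_value G f u \<otimes> word_value G f v"
  using assms(2)
proof (induction u)
  case (Cons l u)
  then show ?case
    using assms word_value_closed[OF assms(1)] by (auto simp: Pi_iff m_assoc)
qed (use assms word_value_closed[OF assms(1)] in auto)

lemma word_value_cong:
  assumes f: "f \<in> X \<rightarrow> carrier G"
    and R: "\<And>u v. (u, v) \<in> R \<Longrightarrow> u \<in> words X \<Longrightarrow> v \<in> words X \<Longrightarrow>
      word_value G f u = word_value G f v"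
    and "pres_eq X R u v"
  shows "word_value G f u = word_value G f v"
  using assms(3)
proof (induction rule: pres_eq.induct)
  case (append u u' v v')
  then show ?case
    using pres_eq_words[of X R] f by (simp add: word_value_append)
next
  case (cancel x e)
  then show ?case using f by (auto simp: Pi_iff)
qed (use R in auto)

end

text \<open>The universal property: the value of a class is read off from any of its words.\<close>

lemma presented_group_lift:
  fixes M :: "('g, 'b) monoid_scheme"
  assumes M: "group M" and f: "f \<in> X \<rightarrow> carrier M"
    and R: "\<And>u v. (u, v) \<in> R \<Longrightarrow> u \<in> words X \<Longrightarrow> v \<in> words X \<Longrightarrow>
      word_value M f u = word_value M f v"
  obtains \<theta> where "\<theta> \<in> hom (presented_group X R) M" "\<And>x. x \<in> X \<Longrightarrow> \<theta> (gen_class X R x) = f x"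
proof -
  interpret M: group M by (rule M)
  define \<theta> where "\<theta> C = word_value M f (SOME u. u \<in> C)" for C
  have \<theta>: "\<theta> (word_class X R u) = word_value M f u" if "u \<in> words X" for u
  proof -
    have "u \<in> word_class X R u"
      using that by (simp add: word_class_def pres_eq.refl)
    then have "(SOME w. w \<in> word_class X R u) \<in> word_class X R u"
      by (rule someI)
    then show ?thesis
      using M.word_value_cong[OF f R] unfolding \<theta>_def word_class_def by auto
  qed
  have "\<theta> \<in> hom (presented_group X R) M"
  proof (rule homI)
    fix C assume "C \<in> carrier (presented_group X R)"
    then show "\<theta> C \<in> carrier M"
      using M.word_value_closed[OF f] by (auto simp: presented_group_def \<theta>)
  next
    fix C D assume "C \<in> carrier (presented_group X R)" "D \<in> carrier (presented_group X R)"
    then obtain u v where "u \<in> words X" "v \<in> words X" "C = word_class X R u" "D = word_class X R v"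
      by (auto simp: presented_group_def)
    then show "\<theta> (C \<otimes>\<^bsub>presented_group X R\<^esub> D) = \<theta> C \<otimes>\<^bsub>M\<^esub> \<theta> D"
      by (simp add: presented_group_mult \<theta> M.word_value_append[OF f])
  qed
  moreover have "\<theta> (gen_class X R x) = f x" if "x \<in> X" for x
    using that f by (auto simp: gen_class_def \<theta> Pi_iff)
  ultimately show ?thesis by (rule that)
qed

lemma gen_class_closed: "x \<in> X \<Longrightarrow> gen_class X R x \<in> carrier (presented_group X R)"
  by (auto simp: gen_class_def presented_group_def)

lemma word_value_presented_group:
  assumes "u \<in> words X"
  shows "word_value (presented_group X R) (gen_class X R) u = word_class X R u"
  using assms
proof (induction u)
  case Nil
  show ?case by (simp add: presented_group_def)
next
  case (Cons l u)
  interpret P: group "presented_group X R" by (rule group_presented_group)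
  obtain x e where l: "l = (x, e)" by (cases l)
  have x: "x \<in> X" using Cons.prems l by simp
  have "word_class X R [(x, True)] \<otimes>\<^bsub>presented_group X R\<^esub> gen_class X R x =
      \<one>\<^bsub>presented_group X R\<^esub>"
    using x pres_eq.cancel[OF x, of R True] unfolding gen_class_def
    by (simp add: presented_group_mult word_class_eq) (simp add: presented_group_def)
  moreover have "word_class X R [(x, True)] \<in> carrier (presented_group X R)"
    using x by (auto simp: presented_group_def)
  ultimately have i: "inv\<^bsub>presented_group X R\<^esub> (gen_class X R x) = word_class X R [(x, True)]"
    by (rule P.inv_equality[OF _ gen_class_closed[OF x]])
  have e: "(if e then inv\<^bsub>presented_group X R\<^esub> (gen_class X R x) else gen_class X R x) =
      word_class X R [(x, e)]"
    using i by (simp add: gen_class_def)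
  have "u \<in> words X" using Cons.prems by simp
  then have "word_value (presented_group X R) (gen_class X R) (l # u) =
      word_class X R [(x, e)] \<otimes>\<^bsub>presented_group X R\<^esub> word_class X R u"
    by (simp only: word_value.simps l fst_conv snd_conv e Cons.IH)
  then show ?case
    using x l \<open>u \<in> words X\<close> by (simp add: presented_group_mult)
qed

lemma presented_group_rel:
  assumes "(u, v) \<in> R" "u \<in> words X" "v \<in> words X"
  shows "word_value (presented_group X R) (gen_class X R) u =
    word_value (presented_group X R) (gen_class X R) v"
  using assms by (simp add: word_value_presented_group word_class_eq pres_eq.rel)

lemma presented_group_induct:
  assumes "C \<in> carrier (presented_group X R)"
    and "P \<one>\<^bsub>presented_group X R\<^esub>"
    and "\<And>C x. C \<in> carrier (presented_group X R) \<Longrightarrow> P C \<Longrightarrow> x \<in> X \<Longrightarrow>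
      P (C \<otimes>\<^bsub>presented_group X R\<^esub> gen_class X R x)"
    and "\<And>C x. C \<in> carrier (presented_group X R) \<Longrightarrow> P C \<Longrightarrow> x \<in> X \<Longrightarrow>
      P (C \<otimes>\<^bsub>presented_group X R\<^esub> inv\<^bsub>presented_group X R\<^esub> (gen_class X R x))"
  shows "P C"
proof -
  interpret P: group "presented_group X R" by (rule group_presented_group)
  have g: "gen_class X R \<in> X \<rightarrow> carrier (presented_group X R)"
    by (simp add: gen_class_closed)
  obtain u where u: "u \<in> words X" "C = word_class X R u"
    using assms(1) by (auto simp: presented_group_def)
  have "P (word_value (presented_group X R) (gen_class X R) u)"
    using u(1)
  proof (induction u rule: rev_induct)
    case Nil
    show ?case by (simp add: assms(2))
  next
    case (snoc l u)
    obtain x e where l: "l = (x, e)" by (cases l)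
    have u: "u \<in> words X" and x: "x \<in> X" using snoc.prems l by auto
    have "word_value (presented_group X R) (gen_class X R) u \<in> carrier (presented_group X R)"
      by (rule P.word_value_closed[OF g u])
    then show ?case
      using assms(3,4) snoc.IH[OF u] x l gen_class_closed[OF x, of R]
      by (cases e) (auto simp: P.word_value_append[OF g u])
  qed
  then show ?thesis by (simp add: u word_value_presented_group)
qed


section \<open>Matrices of size two and the relations between Bruhat elements\<close>

lemma mat2_entries [simp]:
  "entries (mat2 a b c d) $ 1 $ 1 = a" "entries (mat2 a b c d) $ 1 $ 2 = b"
  "entries (mat2 a b c d) $ 2 $ 1 = c" "entries (mat2 a b c d) $ 2 $ 2 = d"
  by (simp_all add: mat2_def)

lemma sqmat2_eq_iff: "x = y \<longleftrightarrow> (\<forall>i j. entries x $ i $ j = entries (y :: ('a, 2) sqmat) $ i $ j)"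
  by (simp add: sqmat_eq_iff vec_eq_iff)

lemma mat2_exhaust: obtains a b c d where "x = mat2 a b c d"
proof
  show "x = mat2 (entries x $ 1 $ 1) (entries x $ 1 $ 2) (entries x $ 2 $ 1) (entries x $ 2 $ 2)"
    by (simp add: sqmat2_eq_iff forall_2)
qed

lemma mat2_eq_iff: "mat2 a b c d = mat2 a' b' c' d' \<longleftrightarrow> a = a' \<and> b = b' \<and> c = c' \<and> d = d'"
  by (auto simp: sqmat2_eq_iff forall_2)

lemma mat2_mult: "mat2 a b c d * mat2 a' b' c' d' =
    mat2 (a * a' + b * c') (a * b' + b * d') (c * a' + d * c') (c * b' + d * d')"
  by (simp add: sqmat2_eq_iff forall_2 matrix_matrix_mult_def sum_2)

lemma mat2_one: "1 = mat2 1 0 0 1"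
  by (simp add: sqmat2_eq_iff forall_2 mat_def)

lemma star_transpose_mat2:
  "star_transpose star (mat2 a b c d) = mat2 (star a) (star c) (star b) (star d)"
  by (simp add: sqmat2_eq_iff forall_2 star_transpose_def)

lemma SL_star_simps [simp]:
  "x \<otimes>\<^bsub>SL_star star\<^esub> y = x * y" "\<one>\<^bsub>SL_star star\<^esub> = 1"
  by (simp_all add: SL_star_def)

context involution
begin

text \<open>The first three equations are the entries of \<open>x\<^sup>* J x = J\<close>; they say that the matrix \<open>?y\<close>
  of the proof is a left inverse of \<open>x\<close>. As \<open>x\<close> is a unit, \<open>?y\<close> is a right inverse, too, and this
  gives the last three equations.\<close>

lemma SL_star_mat2_iff:
  "mat2 a b c d \<in> carrier (SL_star star) \<longleftrightarrow>
    star a * c = star c * a \<and> star b * d = star d * b \<and> star a * d - star c * b = 1 \<and>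
    a * star b = b * star a \<and> c * star d = d * star c \<and> a * star d - b * star c = 1"
    (is "?x \<in> _ \<longleftrightarrow> ?R")
proof -
  let ?y = "mat2 (star d) (- star b) (- star c) (star a)"
  have "star_transpose star ?x * J_mat * ?x = mat2 (star a * c - star c * a)
      (star a * d - star c * b) (star b * c - star d * a) (star b * d - star d * b)"
    by (simp add: J_mat_def star_transpose_mat2 mat2_mult)
  then have J: "star_transpose star ?x * J_mat * ?x = J_mat \<longleftrightarrow>
      star a * c = star c * a \<and> star a * d - star c * b = 1 \<and>
      star b * c - star d * a = - 1 \<and> star b * d = star d * b"
    by (simp add: J_mat_def mat2_eq_iff)
  have 1: "star d * a - star b * c = 1 \<longleftrightarrow> star a * d - star c * b = 1"
    by (metis star_diff star_mult star_one star_star)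
  have 2: "d * star a - c * star b = 1 \<longleftrightarrow> a * star d - b * star c = 1"
    by (metis star_diff star_mult star_one star_star)
  have 3: "star b * c - star d * a = - 1 \<longleftrightarrow> star d * a - star b * c = 1"
    by (metis minus_diff_eq minus_minus)
  have "?y * ?x = mat2 (star d * a - star b * c) (star d * b - star b * d)
      (star a * c - star c * a) (star a * d - star c * b)"
    by (simp add: mat2_mult)
  then have l: "?y * ?x = 1 \<longleftrightarrow> star d * a - star b * c = 1 \<and> star d * b = star b * d \<and>
      star a * c = star c * a \<and> star a * d - star c * b = 1"
    by (simp add: mat2_one mat2_eq_iff)
  have "?x * ?y = mat2 (a * star d - b * star c) (b * star a - a * star b)
      (c * star d - d * star c) (d * star a - c * star b)"
    by (simp add: mat2_mult)
  then have r: "?x * ?y = 1 \<longleftrightarrow> a * star d - b * star c = 1 \<and> b * star a = a * star b \<and>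
      c * star d = d * star c \<and> d * star a - c * star b = 1"
    by (simp add: mat2_one mat2_eq_iff)
  show ?thesis
  proof
    assume x: "?x \<in> carrier (SL_star star)"
    then have "star_transpose star ?x * J_mat * ?x = J_mat" "?x \<in> unit_set"
      by (auto simp: SL_star_def)
    with J l 3 have yx: "?y * ?x = 1" by metis
    then have "?x * ?y = 1" by (rule unit_left_inverse[OF \<open>?x \<in> unit_set\<close>])
    with yx show ?R using l r by metis
  next
    assume R: ?R
    then have "?y * ?x = 1" "?x * ?y = 1" using l r 1 2 by metis+
    then have "?x \<in> unit_set" by (rule unit_setI)
    with R J 1 3 show "?x \<in> carrier (SL_star star)" by (simp add: SL_star_def)
  qed
qed

lemma bruhat_closed:
  "bruhat_w \<in> carrier (SL_star star)"
  "t \<in> unit_set \<Longrightarrow> bruhat_h star t \<in> carrier (SL_star star)"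
  "r \<in> sym \<Longrightarrow> bruhat_u r \<in> carrier (SL_star star)"
  by (simp_all add: bruhat_w_def bruhat_h_def bruhat_u_def SL_star_mat2_iff sym_iff star_unit_inv)

lemma bruhat_relations:
  "s \<in> unit_set \<Longrightarrow> t \<in> unit_set \<Longrightarrow> bruhat_h star s * bruhat_h star t = bruhat_h star (s * t)"
  "bruhat_u q * bruhat_u r = bruhat_u (q + r)"
  "bruhat_w * bruhat_w = bruhat_h star (- 1)"
  "t \<in> unit_set \<Longrightarrow> bruhat_h star t * bruhat_u r = bruhat_u (t * r * star t) * bruhat_h star t"
  "t \<in> unit_set \<Longrightarrow> bruhat_w * bruhat_h star t = bruhat_h star (unit_inv (star t)) * bruhat_w"
  "t \<in> unit_set \<Longrightarrow> t \<in> sym \<Longrightarrow>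
    bruhat_u t * bruhat_w * bruhat_u (unit_inv t) * bruhat_w * bruhat_u t =
    bruhat_w * bruhat_h star (- unit_inv t)"
  by (simp_all add: bruhat_w_def bruhat_h_def bruhat_u_def mat2_mult mat2_eq_iff unit_inv_mult
      mult.assoc add.commute star_unit_inv unit_inv_uminus sym_iff)

end

lemma bruhat_hom_exists:
  assumes "ring_involution star"
  shows "\<exists>\<theta>. is_bruhat_hom star \<theta>"
proof -
  interpret involution star by unfold_locales (rule assms)
  interpret S: group "SL_star star" by (rule group_SL_star[OF assms])
  define f where "f x = (case x of Z \<Rightarrow> bruhat_w | K t \<Rightarrow> bruhat_h star t | V r \<Rightarrow> bruhat_u r)" for x
  have f: "f \<in> H_gens star \<rightarrow> carrier (SL_star star)"
    by (auto simp: H_gens_def f_def bruhat_closed)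
  have R: "word_value (SL_star star) f u = word_value (SL_star star) f v"
    if "(u, v) \<in> H_rels star" for u v
    using that bruhat_relations by (auto simp: H_rels_def f_def mult.assoc)
  obtain \<theta> where \<theta>: "\<theta> \<in> hom (presented_group (H_gens star) (H_rels star)) (SL_star star)"
    "\<And>x. x \<in> H_gens star \<Longrightarrow> \<theta> (gen_class (H_gens star) (H_rels star) x) = f x"
    using presented_group_lift[OF group_SL_star[OF assms] f R] by blast
  have "is_bruhat_hom star \<theta>"
    using \<theta> by (simp add: is_bruhat_hom_def H_group_def H_z_def H_k_def H_v_def H_gens_def f_def)
  then show ?thesis by blast
qed

section \<open>Normal forms in the presented group\<close>

context involution
begin

text \<open>Designed so that \<open>linked r s\<close> puts \<open>y r v\<^sub>s\<close> into \<open>V K Y\<close>. Each rule is the trace of a group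
  identity on the parameters: the last defining relation, the cut \<open>v\<^sub>s = v\<^sub>q v\<^bsub>s-q\<^esub>\<close>, inversion followed
  by conjugation with \<open>z\<close>, and conjugation with an element of \<open>K\<close>. Separating it from the group leaves a
  statement about the ring alone.\<close>

inductive linked :: "'a \<Rightarrow> 'a \<Rightarrow> bool" where
  unit: "r \<in> sym \<Longrightarrow> s \<in> sym \<Longrightarrow> s \<in> unit_set \<Longrightarrow> 1 - r * s \<in> unit_set \<Longrightarrow> linked r s"
| step: "linked r q \<Longrightarrow> 1 - r * q \<in> unit_set \<Longrightarrow>
    linked (unit_inv (1 - r * q) * r) (s - q) \<Longrightarrow> linked r s"
| swap: "linked r s \<Longrightarrow> linked (- s) (- r)"
| conj: "linked (t * r * star t) (star (unit_inv t) * s * unit_inv t) \<Longrightarrow> t \<in> unit_set \<Longrightarrow>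
    r \<in> sym \<Longrightarrow> s \<in> sym \<Longrightarrow> linked r s"

lemma linked_sym: "linked r s \<Longrightarrow> r \<in> sym \<and> s \<in> sym"
proof (induction rule: linked.induct)
  case (step r q s)
  then have "s - q + q \<in> sym" by (intro sym_closed(4)[of "s - q" q]) auto
  moreover have "s - q + q = s" by simp
  ultimately show ?case using step by metis
qed auto

text \<open>The unit condition is multiplicative along a cut of \<open>s\<close> at \<open>q\<close>: the second half of
  the walk satisfies it if the whole walk and the first half do.\<close>

lemma one_minus_move:
  fixes r q s :: 'a
  assumes "1 - r * q \<in> unit_set"
  shows "(1 - r * q) * (1 - unit_inv (1 - r * q) * r * (s - q)) = 1 - r * s"
proof -
  have "(1 - r * q) * (1 - unit_inv (1 - r * q) * r * (s - q)) =
      1 - r * q - (1 - r * q) * (unit_inv (1 - r * q) * (r * (s - q)))"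
    by (simp only: right_diff_distrib[of "1 - r * q" 1] mult_1_right mult.assoc)
  also have "\<dots> = 1 - r * q - r * (s - q)"
    using assms by simp
  finally show ?thesis by (simp add: algebra_simps)
qed

lemma move_unit:
  fixes r q s :: 'a
  assumes "1 - r * q \<in> unit_set" "1 - r * s \<in> unit_set"
  shows "1 - unit_inv (1 - r * q) * r * (s - q) \<in> unit_set"
  using unit_mult_cancel_left[OF assms(1)] one_minus_move[OF assms(1)] assms(2) by metis

lemma linked_two_step:
  assumes "r \<in> sym" "s \<in> sym" "q \<in> sym" "q \<in> unit_set" "s - q \<in> unit_set"
    "1 - r * q \<in> unit_set" "1 - r * s \<in> unit_set"
  shows "linked r s"
proof (rule linked.step)
  show "linked r q" using assms by (intro linked.unit)
  show "linked (unit_inv (1 - r * q) * r) (s - q)"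
    using assms by (intro linked.unit sym_move move_unit) auto
qed (rule assms)

end

text \<open>The homomorphism is part of the locale because matrix entries are used to identify factors
  of group elements.\<close>

locale bruhat_group = involution star + group G
  for star :: "'a::ring_1 \<Rightarrow> 'a" and G :: "('g, 'b) monoid_scheme" (structure) +
  fixes z :: 'g and k v :: "'a \<Rightarrow> 'g" and \<theta> :: "'g \<Rightarrow> ('a, 2) sqmat"
  assumes z_closed [simp]: "z \<in> carrier G"
    and k_closed [simp]: "t \<in> unit_set \<Longrightarrow> k t \<in> carrier G"
    and v_closed [simp]: "r \<in> sym \<Longrightarrow> v r \<in> carrier G"
    and kk: "s \<in> unit_set \<Longrightarrow> t \<in> unit_set \<Longrightarrow> k s \<otimes> k t = k (s * t)"
    and vv: "q \<in> sym \<Longrightarrow> r \<in> sym \<Longrightarrow> v q \<otimes> v r = v (q + r)"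
    and zz: "z \<otimes> z = k (- 1)"
    and kv: "t \<in> unit_set \<Longrightarrow> r \<in> sym \<Longrightarrow> k t \<otimes> v r = v (t * r * star t) \<otimes> k t"
    and zk: "t \<in> unit_set \<Longrightarrow> z \<otimes> k t = k (unit_inv (star t)) \<otimes> z"
    and vzvzv: "t \<in> unit_set \<Longrightarrow> t \<in> sym \<Longrightarrow>
      v t \<otimes> z \<otimes> v (unit_inv t) \<otimes> z \<otimes> v t = z \<otimes> k (- unit_inv t)"
    and hom: "\<theta> \<in> hom G (SL_star star)"
    and hom_z: "\<theta> z = bruhat_w"
    and hom_k: "t \<in> unit_set \<Longrightarrow> \<theta> (k t) = bruhat_h star t"
    and hom_v: "r \<in> sym \<Longrightarrow> \<theta> (v r) = bruhat_u r"
begin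

lemma k_one: "k 1 = \<one>"
  using kk[of 1 1] by simp

lemma v_zero: "v 0 = \<one>"
  using vv[of 0 0] by simp

lemma inv_v: "r \<in> sym \<Longrightarrow> inv (v r) = v (- r)"
  by (rule inv_equality) (simp_all add: vv v_zero)

lemma inv_k: "t \<in> unit_set \<Longrightarrow> inv (k t) = k (unit_inv t)"
  by (rule inv_equality) (simp_all add: kk k_one)

lemma inv_z: "inv z = z \<otimes> k (- 1)"
proof (rule inv_equality)
  have "z \<otimes> k (- 1) \<otimes> z = z \<otimes> (z \<otimes> z) \<otimes> z" by (simp add: zz)
  also have "\<dots> = (z \<otimes> z) \<otimes> (z \<otimes> z)" by (simp add: m_assoc)
  also have "\<dots> = \<one>" by (simp add: zz kk k_one)
  finally show "z \<otimes> k (- 1) \<otimes> z = \<one>" .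
qed auto

definition y :: "'a \<Rightarrow> 'g" where
  "y r = z \<otimes> v r \<otimes> inv z"

lemma y_closed [simp]: "r \<in> sym \<Longrightarrow> y r \<in> carrier G"
  by (simp add: y_def)

lemma y_z: "r \<in> sym \<Longrightarrow> y r \<otimes> z = z \<otimes> v r"
  by (simp add: y_def m_assoc)

lemma yy: "q \<in> sym \<Longrightarrow> r \<in> sym \<Longrightarrow> y q \<otimes> y r = y (q + r)"
proof -
  assume a: "q \<in> sym" "r \<in> sym"
  then have "y q \<otimes> y r \<otimes> z = y q \<otimes> (y r \<otimes> z)" by (simp add: m_assoc)
  also have "y r \<otimes> z = z \<otimes> v r" using a by (simp add: y_z)
  also have "y q \<otimes> (z \<otimes> v r) = y q \<otimes> z \<otimes> v r" using a by (simp add: m_assoc)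
  also have "y q \<otimes> z = z \<otimes> v q" using a by (simp add: y_z)
  also have "z \<otimes> v q \<otimes> v r = z \<otimes> (v q \<otimes> v r)" using a by (simp add: m_assoc)
  also have "\<dots> = y (q + r) \<otimes> z" using a by (simp add: vv y_z)
  finally show ?thesis using a by simp
qed

lemma y_zero: "y 0 = \<one>"
  by (simp add: y_def v_zero)

lemma inv_y: "r \<in> sym \<Longrightarrow> inv (y r) = y (- r)"
  by (rule inv_equality) (simp_all add: yy y_zero)

lemma kz: "t \<in> unit_set \<Longrightarrow> k t \<otimes> z = z \<otimes> k (unit_inv (star t))"
  by (simp add: zk star_unit_inv)

lemma z_y: "r \<in> sym \<Longrightarrow> z \<otimes> y r = v r \<otimes> z"
proof -
  assume r: "r \<in> sym"
  have "z \<otimes> y r = (z \<otimes> z) \<otimes> v r \<otimes> inv z" using r by (simp add: y_def m_assoc)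
  also have "\<dots> = v r \<otimes> k (- 1) \<otimes> inv z" using r by (simp add: zz kv)
  also have "\<dots> = v r \<otimes> (z \<otimes> z) \<otimes> inv z" by (simp add: zz)
  also have "\<dots> = v r \<otimes> z" using r by (simp add: m_assoc)
  finally show ?thesis .
qed

lemma vk: "t \<in> unit_set \<Longrightarrow> r \<in> sym \<Longrightarrow>
    v r \<otimes> k t = k t \<otimes> v (unit_inv t * r * star (unit_inv t))"
  using kv[OF _ sym_closed(6), of t r "unit_inv t"] by (simp add: mult.assoc star_unit_inv)

lemma ky: "t \<in> unit_set \<Longrightarrow> r \<in> sym \<Longrightarrow>
    k t \<otimes> y r = y (star (unit_inv t) * r * unit_inv t) \<otimes> k t"
proof -
  assume a: "t \<in> unit_set" "r \<in> sym"
  let ?t = "unit_inv (star t)" and ?r = "star (unit_inv t) * r * unit_inv t"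
  have r: "?r \<in> sym" using a by simp
  have "k t \<otimes> y r \<otimes> z = k t \<otimes> z \<otimes> v r" using a by (simp add: m_assoc y_z)
  also have "\<dots> = z \<otimes> (k ?t \<otimes> v r)" using a by (simp add: kz m_assoc)
  also have "\<dots> = z \<otimes> (v ?r \<otimes> k ?t)" using a by (simp add: kv star_unit_inv)
  also have "\<dots> = y ?r \<otimes> (z \<otimes> k ?t)" using a r by (simp add: m_assoc[symmetric] y_z)
  also have "\<dots> = y ?r \<otimes> k t \<otimes> z" using a r by (simp add: kz[symmetric] m_assoc)
  finally show ?thesis using a r by simp
qed

lemma yk: "t \<in> unit_set \<Longrightarrow> r \<in> sym \<Longrightarrow> y r \<otimes> k t = k t \<otimes> y (star t * r * t)"
  using ky[OF _ sym_closed(7), of t r t] by (simp add: star_unit_inv mult.assoc)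

text \<open>The last relation, solved for a lower unipotent element.\<close>

lemma y_unit:
  assumes "s \<in> unit_set" "s \<in> sym"
  shows "y s = v (- unit_inv s) \<otimes> z \<otimes> k s \<otimes> v (- unit_inv s)"
proof -
  let ?t = "unit_inv s"
  have t: "?t \<in> unit_set" "?t \<in> sym" using assms by auto
  have "v ?t \<otimes> y s \<otimes> k (- 1) \<otimes> v ?t = v ?t \<otimes> (y s \<otimes> z) \<otimes> z \<otimes> v ?t"
    using assms t by (simp add: m_assoc zz[symmetric])
  also have "\<dots> = z \<otimes> k (- s)"
    using vzvzv[of ?t] assms t by (simp add: y_z m_assoc)
  finally have "v ?t \<otimes> y s \<otimes> (k (- 1) \<otimes> v ?t) = z \<otimes> k (- s)"
    using assms t by (simp add: m_assoc)
  then have "v ?t \<otimes> y s \<otimes> v ?t \<otimes> k (- 1) = z \<otimes> k (- s)"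
    using assms t by (simp add: kv m_assoc)
  then have "v ?t \<otimes> y s \<otimes> v ?t \<otimes> k (- 1) \<otimes> k (- 1) = z \<otimes> k (- s) \<otimes> k (- 1)"
    by simp
  then have *: "v ?t \<otimes> y s \<otimes> v ?t = z \<otimes> k s"
    using assms t by (simp add: m_assoc kk k_one)
  have "y s = v (- ?t) \<otimes> (v ?t \<otimes> y s \<otimes> v ?t) \<otimes> v (- ?t)"
    using assms t by (simp add: inv_v[symmetric] m_assoc inv_solve_left)
  then show ?thesis unfolding * using assms t by (simp add: m_assoc)
qed

text \<open>The conjugate of \<open>y_unit\<close> by \<open>z\<close>.\<close>

lemma v_unit:
  assumes "s \<in> unit_set" "s \<in> sym"
  shows "v s = y (- unit_inv s) \<otimes> z \<otimes> k (unit_inv s) \<otimes> y (- unit_inv s)"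
proof -
  let ?t = "- unit_inv s"
  have t: "?t \<in> unit_set" "?t \<in> sym" using assms by auto
  have "v s \<otimes> z = z \<otimes> y s" using assms by (simp add: z_y)
  also have "\<dots> = (z \<otimes> v ?t) \<otimes> z \<otimes> k s \<otimes> v ?t"
    using assms t by (simp add: y_unit m_assoc)
  also have "\<dots> = y ?t \<otimes> z \<otimes> (z \<otimes> k s) \<otimes> v ?t"
    using assms t by (simp add: y_z m_assoc)
  also have "z \<otimes> k s = k (unit_inv s) \<otimes> z"
    using assms by (simp add: zk sym_iff)
  also have "y ?t \<otimes> z \<otimes> (k (unit_inv s) \<otimes> z) \<otimes> v ?t =
      y ?t \<otimes> z \<otimes> k (unit_inv s) \<otimes> (z \<otimes> v ?t)"
    using assms t by (simp add: m_assoc)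
  also have "\<dots> = y ?t \<otimes> z \<otimes> k (unit_inv s) \<otimes> y ?t \<otimes> z"
    using assms t by (simp add: y_z[symmetric] m_assoc)
  finally show ?thesis using assms t by simp
qed

lemma hom_mult: "g \<in> carrier G \<Longrightarrow> h \<in> carrier G \<Longrightarrow> \<theta> (g \<otimes> h) = \<theta> g * \<theta> h"
  using hom by (simp add: hom_def)

lemma hom_y:
  assumes "r \<in> sym" shows "\<theta> (y r) = mat2 1 0 (- r) 1"
proof -
  have "\<theta> (y r) * bruhat_w = bruhat_w * bruhat_u r"
    using y_z[OF assms] assms by (simp add: hom_mult[symmetric] hom_z[symmetric] hom_v[symmetric])
  then have "\<theta> (y r) * (bruhat_w * mat2 0 (- 1) 1 0) = bruhat_w * bruhat_u r * mat2 0 (- 1) 1 0"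
    by (simp add: mult.assoc[symmetric])
  then show ?thesis
    by (simp add: bruhat_w_def bruhat_u_def mat2_mult mat2_one[symmetric])
qed

text \<open>The set \<open>V K Y\<close> lifts the matrices whose lower right entry is a unit.\<close>

definition VKY :: "'g set" where
  "VKY = {v a \<otimes> k t \<otimes> y b | a t b. a \<in> sym \<and> t \<in> unit_set \<and> b \<in> sym}"

lemma VKY_I: "a \<in> sym \<Longrightarrow> t \<in> unit_set \<Longrightarrow> b \<in> sym \<Longrightarrow> v a \<otimes> k t \<otimes> y b \<in> VKY"
  by (auto simp: VKY_def)

lemma VKY_E:
  assumes "g \<in> VKY"
  obtains a t b where "a \<in> sym" "t \<in> unit_set" "b \<in> sym" "g = v a \<otimes> k t \<otimes> y b"
  using assms by (auto simp: VKY_def)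

lemma VKY_closed: "g \<in> VKY \<Longrightarrow> g \<in> carrier G"
  by (auto simp: VKY_def)

lemma v_VKY: "g \<in> VKY \<Longrightarrow> r \<in> sym \<Longrightarrow> v r \<otimes> g \<in> VKY"
  by (elim VKY_E) (simp add: m_assoc[symmetric] vv VKY_I)

lemma VKY_y: "g \<in> VKY \<Longrightarrow> r \<in> sym \<Longrightarrow> g \<otimes> y r \<in> VKY"
  by (elim VKY_E) (simp add: m_assoc yy, simp add: m_assoc[symmetric] VKY_I)

lemma k_VKY: "g \<in> VKY \<Longrightarrow> t \<in> unit_set \<Longrightarrow> k t \<otimes> g \<in> VKY"
proof (elim VKY_E)
  fix a s b assume a: "a \<in> sym" "s \<in> unit_set" "b \<in> sym" "t \<in> unit_set"
    and g: "g = v a \<otimes> k s \<otimes> y b"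
  have "k t \<otimes> g = v (t * a * star t) \<otimes> k (t * s) \<otimes> y b"
    using a by (simp add: g m_assoc[symmetric] kv) (simp add: m_assoc kk)
  then show ?thesis using a by (simp add: VKY_I)
qed

lemma VKY_k: "g \<in> VKY \<Longrightarrow> t \<in> unit_set \<Longrightarrow> g \<otimes> k t \<in> VKY"
proof (elim VKY_E)
  fix a s b assume a: "a \<in> sym" "s \<in> unit_set" "b \<in> sym" "t \<in> unit_set"
    and g: "g = v a \<otimes> k s \<otimes> y b"
  have "g \<otimes> k t = v a \<otimes> (k s \<otimes> k t) \<otimes> y (star t * b * t)"
    using a by (simp add: g m_assoc yk)
  then show ?thesis using a by (simp add: kk VKY_I)
qed

lemma hom_VKY:
  assumes "a \<in> sym" "t \<in> unit_set" "b \<in> sym"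
  shows "\<theta> (v a \<otimes> k t \<otimes> y b) =
    mat2 (t - a * unit_inv (star t) * b) (a * unit_inv (star t)) (- unit_inv (star t) * b)
      (unit_inv (star t))"
  using assms by (simp add: hom_mult hom_v hom_k hom_y bruhat_u_def bruhat_h_def mat2_mult)

lemma hom_yv:
  assumes "r \<in> sym" "s \<in> sym"
  shows "\<theta> (y r \<otimes> v s) = mat2 1 s (- r) (1 - r * s)"
  using assms by (simp add: hom_mult hom_v hom_y bruhat_u_def mat2_mult)

text \<open>The lower row of the image determines the last factor, so that membership in \<open>V K Y\<close> can be
  proved without carrying the parameters along.\<close>

lemma VKY_last_factor:
  assumes "r \<in> sym" "s \<in> sym" "y r \<otimes> v s \<in> VKY"
  obtains a t where "a \<in> sym" "t \<in> unit_set" "1 - r * s \<in> unit_set"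
    "y r \<otimes> v s = v a \<otimes> k t \<otimes> y (unit_inv (1 - r * s) * r)"
proof -
  obtain a t b where *: "a \<in> sym" "t \<in> unit_set" "b \<in> sym" "y r \<otimes> v s = v a \<otimes> k t \<otimes> y b"
    using assms(3) by (rule VKY_E)
  have "mat2 1 s (- r) (1 - r * s) = mat2 (t - a * unit_inv (star t) * b) (a * unit_inv (star t))
      (- unit_inv (star t) * b) (unit_inv (star t))"
    using hom_yv[OF assms(1,2)] hom_VKY[OF *(1-3)] by (simp only: *(4))
  then have e: "1 - r * s = unit_inv (star t)" "r = unit_inv (star t) * b"
    by (auto simp: mat2_eq_iff)
  have u: "1 - r * s \<in> unit_set" using *(2) by (subst e(1)) simp
  have "unit_inv (1 - r * s) * r = b"
    unfolding e(1) using *(2) by (subst e(2)) simp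
  then show ?thesis using that[OF *(1,2) u] *(4) by simp
qed

text \<open>Substituting \<open>v_unit\<close> for \<open>v\<^sub>s\<close> turns \<open>y r v\<^sub>s\<close> into \<open>y (r - s\<inverse>)\<close> followed by \<open>z\<close> and
  factors from \<open>K\<close> and \<open>Y\<close>. Here \<open>r - s\<inverse>\<close> is a unit, as \<open>(r - s\<inverse>) s = - (1 - r s)\<close>, and substituting
  \<open>y_unit\<close> for \<open>y (r - s\<inverse>)\<close> produces a second \<open>z\<close>; moved next to each other, the two combine
  to \<open>z\<^sup>2\<close>, which lies in \<open>K\<close>.\<close>

lemma yv_unit:
  assumes "r \<in> sym" "s \<in> sym" "s \<in> unit_set" "1 - r * s \<in> unit_set"
  shows "y r \<otimes> v s \<in> VKY"
proof -
  let ?t = "unit_inv s" let ?d = "r - ?t" let ?p = "- unit_inv ?d"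
  have t: "?t \<in> sym" "?t \<in> unit_set" using assms by auto
  have "?d * s = - (1 - r * s)" using assms by (simp add: algebra_simps)
  then have "?d * s \<in> unit_set" using assms(4) by (simp only: unit_uminus)
  then have d: "?d \<in> unit_set" "?d \<in> sym"
    using unit_mult_cancel_right assms t by auto
  have p: "?p \<in> sym" using d by simp
  have "y r \<otimes> v s = (y r \<otimes> y (- ?t)) \<otimes> z \<otimes> k ?t \<otimes> y (- ?t)"
    using assms t by (simp add: v_unit m_assoc)
  also have "y r \<otimes> y (- ?t) = v ?p \<otimes> z \<otimes> k ?d \<otimes> v ?p"
    using assms t y_unit[OF d] by (simp add: yy)
  also have "\<dots> \<otimes> z \<otimes> k ?t \<otimes> y (- ?t) =
      v ?p \<otimes> (z \<otimes> k ?d) \<otimes> v ?p \<otimes> z \<otimes> k ?t \<otimes> y (- ?t)"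
    using assms t d p by (simp add: m_assoc)
  also have "\<dots> = v ?p \<otimes> (k (unit_inv ?d) \<otimes> (z \<otimes> v ?p) \<otimes> z) \<otimes> k ?t \<otimes> y (- ?t)"
    using assms t d p zk[of ?d] by (simp add: sym_iff) (simp add: sym_iff m_assoc)
  also have "\<dots> = v ?p \<otimes> (k (unit_inv ?d) \<otimes> y ?p \<otimes> (z \<otimes> z)) \<otimes> k ?t \<otimes> y (- ?t)"
    using assms t d p by (simp add: y_z[symmetric] m_assoc)
  also have "\<dots> = v ?p \<otimes> k (unit_inv ?d) \<otimes> y ?p \<otimes> k (- 1) \<otimes> k ?t \<otimes> y (- ?t)"
    using assms t d p by (simp add: zz m_assoc)
  also have "\<dots> \<in> VKY"
    using t d p by (intro VKY_y VKY_k VKY_I) auto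
  finally show ?thesis .
qed

lemma linked_imp_VKY: "linked r s \<Longrightarrow> y r \<otimes> v s \<in> VKY"
proof (induction rule: linked.induct)
  case (unit r s)
  then show ?case by (simp add: yv_unit)
next
  case (step r q s)
  have c: "r \<in> sym" "q \<in> sym" "s - q \<in> sym" "unit_inv (1 - r * q) * r \<in> sym"
    using linked_sym step by blast+
  obtain a t where *: "a \<in> sym" "t \<in> unit_set" "1 - r * q \<in> unit_set"
    "y r \<otimes> v q = v a \<otimes> k t \<otimes> y (unit_inv (1 - r * q) * r)"
    using VKY_last_factor[OF c(1,2) step.IH(1)] by blast
  have "y r \<otimes> v s = y r \<otimes> v q \<otimes> v (s - q)"
    using c by (simp add: m_assoc vv)
  also have "\<dots> = v a \<otimes> (k t \<otimes> (y (unit_inv (1 - r * q) * r) \<otimes> v (s - q)))"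
    using c * by (simp add: m_assoc)
  also have "\<dots> \<in> VKY"
    using * step.IH by (intro v_VKY k_VKY) auto
  finally show ?case .
next
  case (swap r s)
  have c: "r \<in> sym" "s \<in> sym" using linked_sym swap by blast+
  obtain a t b where *: "a \<in> sym" "t \<in> unit_set" "b \<in> sym" "y r \<otimes> v s = v a \<otimes> k t \<otimes> y b"
    using swap.IH by (rule VKY_E)
  have "v (- s) \<otimes> y (- r) = inv (y r \<otimes> v s)"
    using c by (simp add: inv_mult_group inv_v inv_y)
  also have "\<dots> = y (- b) \<otimes> k (unit_inv t) \<otimes> v (- a)"
    using *(1-3) unfolding *(4) by (simp add: inv_mult_group inv_v inv_y inv_k m_assoc)
  finally have "v (- s) \<otimes> y (- r) = y (- b) \<otimes> k (unit_inv t) \<otimes> v (- a)" .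
  then have "z \<otimes> (v (- s) \<otimes> y (- r)) = z \<otimes> (y (- b) \<otimes> k (unit_inv t) \<otimes> v (- a))"
    by simp
  moreover have "z \<otimes> (v (- s) \<otimes> y (- r)) = y (- s) \<otimes> v (- r) \<otimes> z"
    using c by (simp add: m_assoc z_y[symmetric]) (simp add: m_assoc[symmetric] y_z)
  moreover have "z \<otimes> (y (- b) \<otimes> k (unit_inv t) \<otimes> v (- a)) =
      v (- b) \<otimes> k (star t) \<otimes> y (- a) \<otimes> z"
  proof -
    have "z \<otimes> (y (- b) \<otimes> k (unit_inv t) \<otimes> v (- a)) = (z \<otimes> y (- b)) \<otimes> k (unit_inv t) \<otimes> v (- a)"
      using *(1-3) by (simp add: m_assoc)
    also have "\<dots> = v (- b) \<otimes> (z \<otimes> k (unit_inv t)) \<otimes> v (- a)"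
      using *(1-3) by (simp add: z_y) (simp add: m_assoc)
    also have "z \<otimes> k (unit_inv t) = k (star t) \<otimes> z"
      using *(1-3) by (simp add: zk star_unit_inv)
    also have "v (- b) \<otimes> (k (star t) \<otimes> z) \<otimes> v (- a) = v (- b) \<otimes> k (star t) \<otimes> (z \<otimes> v (- a))"
      using *(1-3) by (simp add: m_assoc)
    also have "\<dots> = v (- b) \<otimes> k (star t) \<otimes> y (- a) \<otimes> z"
      using *(1-3) by (simp add: y_z[symmetric]) (simp add: m_assoc)
    finally show ?thesis .
  qed
  ultimately have "y (- s) \<otimes> v (- r) \<otimes> z = v (- b) \<otimes> k (star t) \<otimes> y (- a) \<otimes> z" by metis
  then have "y (- s) \<otimes> v (- r) = v (- b) \<otimes> k (star t) \<otimes> y (- a)"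
    using c * by simp
  then show ?case using * by (simp add: VKY_I)
next
  case (conj t r s)
  let ?u = "star (unit_inv t)"
  let ?r = "t * r * star t" and ?s = "?u * s * unit_inv t"
  have u: "?u \<in> unit_set" "unit_inv ?u = star t" using conj by (simp_all add: star_unit_inv)
  have c: "?r \<in> sym" "?s \<in> sym" using conj by auto
  have "k ?u \<otimes> (y r \<otimes> v s) = y ?r \<otimes> (k ?u \<otimes> v s)"
    using u conj c by (simp add: m_assoc[symmetric] ky)
  also have "\<dots> = y ?r \<otimes> v ?s \<otimes> k ?u"
    using u conj c by (simp add: kv m_assoc)
  also have "\<dots> \<in> VKY"
    using conj.IH u by (intro VKY_k) auto
  finally have "k (star t) \<otimes> (k ?u \<otimes> (y r \<otimes> v s)) \<in> VKY"
    by (rule k_VKY) (use conj in auto)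
  moreover have "k (star t) \<otimes> (k ?u \<otimes> (y r \<otimes> v s)) = y r \<otimes> v s"
    using conj u by (simp add: m_assoc[symmetric] kk star_unit_inv k_one)
  ultimately show ?case by simp
qed

text \<open>Every element of the group will turn out to have such a form, though not a unique one.\<close>

definition VKYV :: "'g set" where
  "VKYV = {g \<otimes> v c | g c. g \<in> VKY \<and> c \<in> sym}"

lemma VKYV_I: "g \<in> VKY \<Longrightarrow> c \<in> sym \<Longrightarrow> g \<otimes> v c \<in> VKYV"
  by (auto simp: VKYV_def)

lemma VKYV_E:
  assumes "g \<in> VKYV" obtains h c where "h \<in> VKY" "c \<in> sym" "g = h \<otimes> v c"
  using assms by (auto simp: VKYV_def)

lemma VKYV_v: "g \<in> VKYV \<Longrightarrow> r \<in> sym \<Longrightarrow> g \<otimes> v r \<in> VKYV"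
  by (elim VKYV_E) (simp add: m_assoc vv VKY_closed VKYV_I)

lemma VKYV_k: "g \<in> VKYV \<Longrightarrow> t \<in> unit_set \<Longrightarrow> g \<otimes> k t \<in> VKYV"
proof (elim VKYV_E)
  fix h c assume a: "h \<in> VKY" "c \<in> sym" "t \<in> unit_set" and g: "g = h \<otimes> v c"
  have "g \<otimes> k t = h \<otimes> k t \<otimes> v (unit_inv t * c * star (unit_inv t))"
    using a VKY_closed[OF a(1)] by (simp add: g m_assoc vk)
  then show ?thesis using a by (simp add: VKYV_I VKY_k)
qed

end

text \<open>The two properties of the ring on which injectivity rests. The second one provides a symmetric
  \<open>p\<close> that is, as a Lagrangian, transversal to two given ones.\<close>

locale linked_bruhat_group = bruhat_group +
  assumes linked_all: "r \<in> sym \<Longrightarrow> s \<in> sym \<Longrightarrow> 1 - r * s \<in> unit_set \<Longrightarrow> linked r s"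
    and common_unit: "r \<in> sym \<Longrightarrow> s \<in> sym \<Longrightarrow>
      \<exists>p\<in>sym. p - s \<in> unit_set \<and> 1 - r * p \<in> unit_set"
begin

text \<open>The obstacle is \<open>y b v\<^sub>c z\<close>. Writing \<open>v\<^sub>c = v\<^sub>p v\<^bsub>-q\<^esub>\<close> with a unit \<open>q = p - c\<close>, the relation
  \<open>y_unit\<close> absorbs \<open>z\<close> into \<open>v\<^bsub>-q\<^esub> z\<close>, which becomes an element of \<open>Y V K\<close>; and \<open>y b v\<^sub>p\<close> lies in \<open>V K Y\<close>
  if \<open>1 - b p\<close> is a unit.\<close>

lemma VKYV_z:
  assumes "g \<in> VKYV" shows "g \<otimes> z \<in> VKYV"
proof -
  obtain h c where h: "h \<in> VKY" "c \<in> sym" and g: "g = h \<otimes> v c"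
    using assms by (rule VKYV_E)
  obtain a t b where *: "a \<in> sym" "t \<in> unit_set" "b \<in> sym" "h = v a \<otimes> k t \<otimes> y b"
    using h(1) by (rule VKY_E)
  obtain p where p: "p \<in> sym" "p - c \<in> unit_set" "1 - b * p \<in> unit_set"
    using common_unit[OF *(3) h(2)] by blast
  define q where "q = p - c"
  let ?s = "unit_inv q"
  have q: "q \<in> sym" "q \<in> unit_set" using p h by (auto simp: q_def)
  then have s: "?s \<in> sym" "?s \<in> unit_set" by auto
  have "y ?s = v (- q) \<otimes> z \<otimes> k ?s \<otimes> v (- q)"
    using y_unit[of ?s] q s by simp
  then have "y ?s \<otimes> v q \<otimes> k q = v (- q) \<otimes> z \<otimes> k ?s \<otimes> (v (- q) \<otimes> v q) \<otimes> k q"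
    using q s by (simp add: m_assoc)
  also have "\<dots> = v (- q) \<otimes> z \<otimes> (k ?s \<otimes> k q)"
    using q s by (simp add: vv v_zero m_assoc)
  also have "k ?s \<otimes> k q = \<one>" using q s by (simp add: kk k_one)
  finally have "v (- q) \<otimes> z = y ?s \<otimes> v q \<otimes> k q" using q by simp
  moreover have "v c = v p \<otimes> v (- q)" using p h q by (simp add: vv q_def)
  ultimately have "g \<otimes> z = v a \<otimes> (k t \<otimes> (y b \<otimes> v p)) \<otimes> y ?s \<otimes> v q \<otimes> k q"
    unfolding g *(4) using *(1-3) q s p h(2) by (simp add: m_assoc)
  also have "\<dots> \<in> VKYV"
    using *(1-3) q s p h(2) linked_imp_VKY[OF linked_all[OF *(3) p(1) p(3)]]
    by (intro VKYV_k VKYV_I VKY_y v_VKY k_VKY) auto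
  finally show ?thesis .
qed

text \<open>Over the identity matrix the lower left entry kills the factor from \<open>Y\<close>, and on
  \<open>V K\<close> the homomorphism is visibly injective.\<close>

lemma VKYV_kernel:
  assumes "g \<in> VKYV" "\<theta> g = 1" shows "g = \<one>"
proof -
  obtain h c where h: "h \<in> VKY" "c \<in> sym" and g: "g = h \<otimes> v c"
    using assms(1) by (rule VKYV_E)
  obtain a t b where *: "a \<in> sym" "t \<in> unit_set" "b \<in> sym" "h = v a \<otimes> k t \<otimes> y b"
    using h(1) by (rule VKY_E)
  have 1: "\<theta> h * \<theta> (v c) = 1"
    using assms h by (simp add: g hom_mult VKY_closed)
  then have "unit_inv (star t) * b = 0"
    using * h by (simp add: hom_VKY hom_v bruhat_u_def mat2_mult mat2_one mat2_eq_iff)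
  then have "star t * (unit_inv (star t) * b) = 0" by simp
  then have b: "b = 0" using *(2) by simp
  have 2: "t = 1 \<and> t * c + a * unit_inv (star t) = 0"
    using 1 * h by (auto simp: b hom_VKY hom_v bruhat_u_def mat2_mult mat2_one mat2_eq_iff)
  then have t: "t = 1" ..
  have "a + c = 0" using 2 unfolding t by (simp add: add.commute)
  then show ?thesis
    using * h by (simp add: g b t y_zero k_one vv v_zero)
qed

end

section \<open>Local rings\<close>

lemma left_ideal_in_maximal:
  assumes "left_ideal (I :: 'a::ring_1 set)" "1 \<notin> I"
  obtains M where "maximal_left_ideal M" "I \<subseteq> M"
proof -
  let ?A = "{L. left_ideal L \<and> I \<subseteq> L \<and> (1 :: 'a) \<notin> L}"
  have top: "L = UNIV" if "left_ideal L" "1 \<in> L" for L :: "'a set"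
    using that unfolding left_ideal_def by (metis UNIV_eq_I mult_1_right)
  have "\<exists>M\<in>?A. \<forall>X\<in>?A. M \<subseteq> X \<longrightarrow> X = M"
  proof (rule subset_Zorn_nonempty)
    show "?A \<noteq> {}" using assms by blast
  next
    fix C assume C: "C \<noteq> {}" "subset.chain ?A C"
    then have sub: "C \<subseteq> ?A" and chain: "\<And>X Y. X \<in> C \<Longrightarrow> Y \<in> C \<Longrightarrow> X \<subseteq> Y \<or> Y \<subseteq> X"
      by (auto simp: subset.chain_def)
    have add: "x + y \<in> \<Union>C" if xy: "x \<in> \<Union>C" "y \<in> \<Union>C" for x y
    proof -
      obtain X Y where XY: "X \<in> C" "Y \<in> C" "x \<in> X" "y \<in> Y" using xy by blast
      then obtain W where "W \<in> C" "x \<in> W" "y \<in> W" using chain by blast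
      moreover have "left_ideal W" using sub \<open>W \<in> C\<close> by blast
      ultimately show ?thesis unfolding left_ideal_def by blast
    qed
    have "left_ideal (\<Union>C)"
      unfolding left_ideal_def
    proof (intro conjI ballI allI)
      show "0 \<in> \<Union>C" using C(1) sub unfolding left_ideal_def by blast
    next
      fix a x assume "x \<in> \<Union>C"
      then show "a * x \<in> \<Union>C" using sub unfolding left_ideal_def by blast
    qed (use add in blast)
    moreover have "I \<subseteq> \<Union>C" using C(1) sub by fast
    moreover have "1 \<notin> \<Union>C" using sub by fast
    ultimately show "\<Union>C \<in> ?A" by simp
  qed
  then obtain M where "M \<in> ?A" and m: "\<forall>X\<in>?A. M \<subseteq> X \<longrightarrow> X = M" ..
  then have M: "left_ideal M" "I \<subseteq> M" "1 \<notin> M" by auto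
  have max: "X = M" if "left_ideal X" "I \<subseteq> X" "1 \<notin> X" "M \<subseteq> X" for X
    using m that by simp
  have "maximal_left_ideal M"
    unfolding maximal_left_ideal_def
  proof (intro conjI allI impI)
    fix L assume L: "left_ideal L \<and> M \<subseteq> L"
    show "L = M \<or> L = UNIV"
    proof (cases "1 \<in> L")
      case True
      then show ?thesis using top L by blast
    next
      case False
      then show ?thesis using max[of L] L M(2) by auto
    qed
  qed (use M in auto)
  then show ?thesis using M(2) by (rule that)
qed

text \<open>An element \<open>x\<close> outside the maximal left ideal has a left inverse \<open>y\<close>, since the left ideal
  generated by \<open>x\<close> is not proper. If \<open>y\<close> were in the maximal left ideal, \<open>1 - x y\<close> would have a left
  inverse, contrary to \<open>(1 - x y) x = 0\<close>. So \<open>y\<close> has a left inverse as well, and \<open>x\<close> is a unit.\<close>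

lemma local_ring_nonunits:
  assumes "local_ring TYPE('a::ring_1)"
  shows "maximal_left_ideal (- unit_set :: 'a set)" "jacobson_radical = (- unit_set :: 'a set)"
proof -
  obtain M :: "'a set" where M: "maximal_left_ideal M" and unique: "\<And>L. maximal_left_ideal L \<Longrightarrow> L = M"
    using assms unfolding local_ring_def by blast
  have ideal: "left_ideal M" and proper: "M \<noteq> UNIV"
    using M by (auto simp: maximal_left_ideal_def)
  have ml: "a * x \<in> M" if "x \<in> M" for a x using ideal that unfolding left_ideal_def by blast
  have mo: "1 \<notin> M" using proper ml by (metis UNIV_eq_I mult_1_right)
  have inv: "\<exists>y. y * x = 1" if "x \<notin> M" for x
  proof (rule ccontr)
    let ?I = "range (\<lambda>a. a * x)"
    assume "\<nexists>y. y * x = 1"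
    then have "1 \<notin> ?I" by (metis imageE)
    moreover have "left_ideal ?I"
      unfolding left_ideal_def by (auto simp: image_iff simp flip: mult.assoc distrib_right intro: exI[of _ 0])
    ultimately obtain L where "maximal_left_ideal L" "?I \<subseteq> L"
      using left_ideal_in_maximal by blast
    then have "1 * x \<in> M" using unique by blast
    with that show False by simp
  qed
  have "x \<in> M \<longleftrightarrow> x \<notin> unit_set" for x
  proof
    assume "x \<in> M"
    show "x \<notin> unit_set"
    proof
      assume "x \<in> unit_set"
      then have "unit_inv x * x \<in> M" "unit_inv x * x = 1" using ml \<open>x \<in> M\<close> by (blast, simp)
      with mo show False by simp
    qed
  next
    assume x: "x \<notin> unit_set"
    show "x \<in> M"
    proof (rule ccontr)
      assume n: "x \<notin> M"
      then obtain y where y: "y * x = 1" using inv by blast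
      have "y \<notin> M"
      proof
        assume "y \<in> M"
        then have "x * y \<in> M" by (rule ml)
        then have "1 - x * y \<notin> M"
          using mo ideal unfolding left_ideal_def by (metis diff_add_cancel)
        then obtain u where "u * (1 - x * y) = 1" using inv by blast
        then have "u * (1 - x * y) * x = x" by simp
        moreover have "(1 - x * y) * x = 0" using y by (simp add: algebra_simps)
        ultimately have "x = 0" by (metis mult.assoc mult_zero_right)
        with n ideal show False by (simp add: left_ideal_def)
      qed
      then obtain u where u: "u * y = 1" using inv by blast
      have "u = u * (y * x)" by (simp add: y)
      also have "\<dots> = x" by (simp add: u flip: mult.assoc)
      finally have "x * y = 1" using u by simp
      with y x show False by (blast intro: unit_setI)
    qed
  qed
  then have e: "M = - unit_set" by blast
  show "maximal_left_ideal (- unit_set :: 'a set)" using M unfolding e .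
  have "{I. maximal_left_ideal I} = {M}" using M unique by blast
  then show "jacobson_radical = (- unit_set :: 'a set)" by (simp add: jacobson_radical_def e)
qed

lemma local_ring_nonunit_add:
  fixes x y :: "'a::ring_1"
  assumes "local_ring TYPE('a)" "x \<notin> unit_set" "y \<notin> unit_set"
  shows "x + y \<notin> unit_set"
  using local_ring_nonunits(1)[OF assms(1)] assms(2,3)
  unfolding maximal_left_ideal_def left_ideal_def by blast

text \<open>Four residue classes leave three nonzero ones, and a representative of a nonzero class is
  a unit.\<close>

lemma three_residues:
  assumes loc: "local_ring TYPE('a::ring_1)"
    and card: "infinite (radical_quotient :: 'a::ring_1 set set) \<or>
      card (radical_quotient :: 'a::ring_1 set set) > 3"
  obtains a b c :: "'a::ring_1" where "a \<in> unit_set" "b \<in> unit_set" "c \<in> unit_set"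
    "a - b \<in> unit_set" "a - c \<in> unit_set" "b - c \<in> unit_set"
proof -
  let ?Q = "radical_quotient :: 'a set set"
  let ?E = "{(x, y). x - y \<notin> (unit_set :: 'a set)}"
  let ?c = "\<lambda>x. ?E `` {x}"
  have zero: "0 \<notin> (unit_set :: 'a set)"
    using local_ring_nonunits(1)[OF loc] by (auto simp: maximal_left_ideal_def left_ideal_def)
  have Q: "?Q = range ?c"
    by (auto simp: radical_quotient_def quotient_def local_ring_nonunits[OF loc])
  have eq: "?c x = ?c y" if "x - y \<notin> unit_set" for x y
  proof -
    have "y - x \<notin> unit_set" using that by (simp add: unit_diff_commute)
    then have "x - w \<notin> unit_set \<longleftrightarrow> y - w \<notin> unit_set" for w
      using that local_ring_nonunit_add[OF loc, of "x - y" "y - w"]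
        local_ring_nonunit_add[OF loc, of "y - x" "x - w"] by auto
    then show ?thesis by auto
  qed
  have "\<exists>B\<subseteq>?Q - {?c 0}. finite B \<and> card B = 3"
  proof (cases "finite ?Q")
    case True
    moreover have "?c 0 \<in> ?Q" unfolding Q by (rule rangeI)
    ultimately have "3 \<le> card (?Q - {?c 0})"
      using card by (subst card_Diff_singleton) simp_all
    then show ?thesis using obtain_subset_with_card_n by metis
  next
    case False
    then have "infinite (?Q - {?c 0})" by simp
    then show ?thesis using infinite_arbitrarily_large by blast
  qed
  then obtain B where B: "B \<subseteq> ?Q - {?c 0}" "card B = 3" by blast
  then obtain X Y W where XYW: "B = {X, Y, W}" "X \<noteq> Y" "X \<noteq> W" "Y \<noteq> W"
    by (auto simp: card_3_iff)
  have "X \<in> range ?c" "Y \<in> range ?c" "W \<in> range ?c" using B XYW(1) Q by auto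
  then obtain a b c where abc: "X = ?c a" "Y = ?c b" "W = ?c c" by (elim rangeE)
  have ne: "?c a \<noteq> ?c 0" "?c b \<noteq> ?c 0" "?c c \<noteq> ?c 0"
    using B(1) unfolding XYW(1) abc by auto
  have un: "x - y \<in> unit_set" if "?c x \<noteq> ?c y" for x y using eq that by blast
  show ?thesis
    using that[of a b c] un[OF ne(1)] un[OF ne(2)] un[OF ne(3)] un[OF XYW(2)[unfolded abc]]
      un[OF XYW(3)[unfolded abc]] un[OF XYW(4)[unfolded abc]] by simp
qed

locale local_involution = involution star for star :: "'a::ring_1 \<Rightarrow> 'a" +
  assumes nonunit_add: "x \<notin> unit_set \<Longrightarrow> y \<notin> unit_set \<Longrightarrow> x + y \<notin> (unit_set :: 'a set)"
    and two_unit: "(2 :: 'a) \<in> unit_set"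
begin

text \<open>The element \<open>y x\<close> is idempotent, and \<open>y x\<close> or \<open>1 - y x\<close> is a unit.\<close>

lemma one_sided_unit:
  assumes "x * y = (1 :: 'a)" shows "x \<in> unit_set" "y \<in> unit_set"
proof -
  let ?e = "y * x"
  have idem: "?e * ?e = ?e" by (metis assms mult.assoc mult_1_left)
  have "?e \<in> unit_set \<or> 1 - ?e \<in> unit_set"
    using nonunit_add[of ?e "1 - ?e"] by auto
  then have "?e = 1"
  proof
    assume u: "?e \<in> unit_set"
    have "?e = unit_inv ?e * (?e * ?e)" by (metis idem u unit_inv_cancel_left(1) mult.assoc)
    then show ?thesis using idem u by simp
  next
    assume u: "1 - ?e \<in> unit_set"
    have "(1 - ?e) * ?e = 0" using idem by (simp add: algebra_simps)
    then have "unit_inv (1 - ?e) * ((1 - ?e) * ?e) = 0" by simp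
    then have "?e = 0" using u by simp
    then have "x * ?e * y = 0" by simp
    then have "(x * y) * (x * y) = 0" by (simp add: mult.assoc)
    then show ?thesis by (simp add: assms)
  qed
  with assms show "x \<in> unit_set" "y \<in> unit_set" by (blast intro: unit_setI)+
qed

lemma unit_factors:
  assumes "x * y \<in> (unit_set :: 'a set)" shows "x \<in> unit_set" "y \<in> unit_set"
proof -
  have "x * (y * unit_inv (x * y)) = 1" using assms by (simp flip: mult.assoc)
  then show "x \<in> unit_set" by (rule one_sided_unit)
  have "unit_inv (x * y) * x * y = 1" using assms by (simp add: mult.assoc)
  then show "y \<in> unit_set" by (rule one_sided_unit)
qed

lemma nonunit_mult:
  fixes x y :: 'a
  assumes "x \<notin> unit_set" shows "x * y \<notin> unit_set" "y * x \<notin> unit_set"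
  using assms unit_factors(1)[of x y] unit_factors(2)[of y x] by auto

lemma nonunit_zero: "(0 :: 'a) \<notin> unit_set"
  using unit_inv_left[of "0 :: 'a"] by auto

lemma nonunit_sum: "(\<And>i. i \<in> I \<Longrightarrow> f i \<notin> unit_set) \<Longrightarrow> sum f I \<notin> (unit_set :: 'a set)"
  by (induction I rule: infinite_finite_induct) (auto simp: nonunit_zero nonunit_add)

lemma nonunit_diff: "x \<notin> unit_set \<Longrightarrow> y \<notin> unit_set \<Longrightarrow> x - y \<notin> (unit_set :: 'a set)"
  using nonunit_add[of x "- y"] by simp

lemma unit_add_nonunit:
  fixes x y :: 'a
  assumes "x \<in> unit_set" "y \<notin> unit_set"
  shows "x + y \<in> unit_set" "x - y \<in> unit_set" "y - x \<in> unit_set" "y + x \<in> unit_set"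
  using nonunit_diff[of "x + y" y] nonunit_add[of "x - y" y] assms
  by (auto simp: unit_diff_commute add.commute)

text \<open>Among \<open>0\<close>, \<open>1\<close> and \<open>-1\<close>, which are pairwise different modulo the radical, at least one
  avoids two given residues.\<close>

lemma avoid_two_residues:
  fixes x y :: 'a
  obtains e where "e \<in> {0, 1, - 1 :: 'a}" "e - x \<in> unit_set" "e - y \<in> unit_set"
proof -
  have *: "e - x \<in> unit_set \<or> e' - x \<in> unit_set"
    if "e - e' \<in> unit_set" for e e' x :: 'a
    using nonunit_diff[of "e - x" "e' - x"] that by auto
  have "- 1 - (1 :: 'a) = - 2" by simp
  then have "- 1 - (1 :: 'a) \<in> unit_set" using two_unit by (simp only: unit_uminus)
  then have "(0 - x \<in> unit_set \<or> 1 - x \<in> unit_set) \<and> (0 - x \<in> unit_set \<or> - 1 - x \<in> unit_set) \<and>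
     (- 1 - x \<in> unit_set \<or> 1 - x \<in> unit_set)" for x :: 'a
    using *[of 0 1 x] *[of 0 "- 1" x] *[of "- 1" 1 x] by auto
  from this[of x] this[of y] show ?thesis using that[of 0] that[of 1] that[of "- 1"] by blast
qed

end

section \<open>Perturbations of rank one\<close>

text \<open>Columns and rows of length \<open>m\<close> are functions on the index type. As the ring is not
  commutative, scalars act on columns from the right and on rows from the left.\<close>

definition outer :: "('m \<Rightarrow> 'a) \<Rightarrow> ('m \<Rightarrow> 'a) \<Rightarrow> ('a::ring_1, 'm::finite) sqmat" where
  "outer u v = of_entries (\<chi> i j. u i * v j)"

definition mat_vec :: "('a::ring_1, 'm::finite) sqmat \<Rightarrow> ('m \<Rightarrow> 'a) \<Rightarrow> 'm \<Rightarrow> 'a" where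
  "mat_vec a u = (\<lambda>i. \<Sum>j\<in>UNIV. entries a $ i $ j * u j)"

definition vec_mat :: "('m \<Rightarrow> 'a) \<Rightarrow> ('a::ring_1, 'm::finite) sqmat \<Rightarrow> 'm \<Rightarrow> 'a" where
  "vec_mat v a = (\<lambda>j. \<Sum>i\<in>UNIV. v i * entries a $ i $ j)"

definition dot :: "('m::finite \<Rightarrow> 'a::ring_1) \<Rightarrow> ('m \<Rightarrow> 'a) \<Rightarrow> 'a" where
  "dot v u = (\<Sum>i\<in>UNIV. v i * u i)"

definition rscale :: "('m \<Rightarrow> 'a::ring_1) \<Rightarrow> 'a \<Rightarrow> 'm \<Rightarrow> 'a" where
  "rscale u c = (\<lambda>i. u i * c)"

definition lscale :: "'a::ring_1 \<Rightarrow> ('m \<Rightarrow> 'a) \<Rightarrow> 'm \<Rightarrow> 'a" where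
  "lscale c v = (\<lambda>i. c * v i)"

definition unit_vec :: "'m \<Rightarrow> 'm \<Rightarrow> 'a::ring_1" where
  "unit_vec i = (\<lambda>j. if j = i then 1 else 0)"

lemma sqmatI: "(\<And>i j. entries x $ i $ j = entries y $ i $ j) \<Longrightarrow> x = y"
  by (simp add: sqmat_eq_iff vec_eq_iff)

lemma entries_outer [simp]: "entries (outer u v) $ i $ j = u i * v j"
  by (simp add: outer_def)

lemma entries_mult: "entries (a * b) $ i $ j = (\<Sum>k\<in>UNIV. entries a $ i $ k * entries b $ k $ j)"
  by (simp add: matrix_matrix_mult_def)

lemma entries_star [simp]: "entries (star_transpose star x) $ i $ j = star (entries x $ j $ i)"
  by (simp add: star_transpose_def)

lemma mult_outer: "a * outer u v = outer (mat_vec a u) v"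
  by (rule sqmatI) (simp add: matrix_matrix_mult_def mat_vec_def sum_distrib_right mult.assoc)

lemma outer_mult: "outer u v * a = outer u (vec_mat v a)"
  by (rule sqmatI) (simp add: matrix_matrix_mult_def vec_mat_def sum_distrib_left mult.assoc)

lemma mat_vec_mult: "mat_vec (a * b) u = mat_vec a (mat_vec b u)"
proof
  fix i
  have "mat_vec (a * b) u i = (\<Sum>j\<in>UNIV. \<Sum>k\<in>UNIV. entries a $ i $ k * (entries b $ k $ j * u j))"
    by (simp add: mat_vec_def matrix_matrix_mult_def sum_distrib_right mult.assoc)
  also have "\<dots> = mat_vec a (mat_vec b u) i"
    by (subst sum.swap) (simp add: mat_vec_def sum_distrib_left)
  finally show "mat_vec (a * b) u i = mat_vec a (mat_vec b u) i" .
qed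

lemma vec_mat_mult: "vec_mat v (a * b) = vec_mat (vec_mat v a) b"
proof
  fix j
  have "vec_mat v (a * b) j = (\<Sum>i\<in>UNIV. \<Sum>k\<in>UNIV. v i * entries a $ i $ k * entries b $ k $ j)"
    by (simp add: vec_mat_def matrix_matrix_mult_def sum_distrib_left mult.assoc)
  also have "\<dots> = vec_mat (vec_mat v a) b j"
    by (subst sum.swap) (simp add: vec_mat_def sum_distrib_right)
  finally show "vec_mat v (a * b) j = vec_mat (vec_mat v a) b j" .
qed

lemma dot_vec_mat: "dot (vec_mat v a) u = dot v (mat_vec a u)"
proof -
  have "dot (vec_mat v a) u = (\<Sum>j\<in>UNIV. \<Sum>i\<in>UNIV. v i * (entries a $ i $ j * u j))"
    by (simp add: dot_def vec_mat_def sum_distrib_right mult.assoc)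
  also have "\<dots> = dot v (mat_vec a u)"
    by (subst sum.swap) (simp add: dot_def mat_vec_def sum_distrib_left)
  finally show ?thesis .
qed

lemma mat_vec_outer: "mat_vec (outer u v) w = rscale u (dot v w)"
  by (simp add: fun_eq_iff mat_vec_def rscale_def dot_def sum_distrib_left mult.assoc)

lemma vec_mat_outer: "vec_mat w (outer u v) = lscale (dot w u) v"
  by (simp add: fun_eq_iff vec_mat_def lscale_def dot_def sum_distrib_right mult.assoc)

lemma outer_rscale: "outer (rscale u c) v = outer u (lscale c v)"
  by (rule sqmatI) (simp add: rscale_def lscale_def mult.assoc)

lemma dot_rscale: "dot v (rscale u c) = dot v u * c"
  by (simp add: dot_def rscale_def sum_distrib_right mult.assoc)

lemma dot_lscale: "dot (lscale c v) u = c * dot v u"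
  by (simp add: dot_def lscale_def sum_distrib_left mult.assoc)

lemma mat_vec_rscale: "mat_vec a (rscale u c) = rscale (mat_vec a u) c"
  by (simp add: fun_eq_iff mat_vec_def rscale_def sum_distrib_right mult.assoc)

lemma vec_mat_lscale: "vec_mat (lscale c v) a = lscale c (vec_mat v a)"
  by (simp add: fun_eq_iff vec_mat_def lscale_def sum_distrib_left mult.assoc)

lemma mat_vec_simps:
  "mat_vec 0 u = (\<lambda>_. 0)" "mat_vec 1 u = u" "mat_vec (a + b) u = (\<lambda>i. mat_vec a u i + mat_vec b u i)"
  "mat_vec (a - b) u = (\<lambda>i. mat_vec a u i - mat_vec b u i)" "mat_vec (- a) u = (\<lambda>i. - mat_vec a u i)"
  by (simp_all add: fun_eq_iff mat_vec_def algebra_simps sum.distrib sum_subtractf mat_def if_distrib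
      if_distribR sum_negf cong: if_cong)

lemma vec_mat_simps:
  "vec_mat v 0 = (\<lambda>_. 0)" "vec_mat v 1 = v" "vec_mat v (a + b) = (\<lambda>i. vec_mat v a i + vec_mat v b i)"
  "vec_mat v (a - b) = (\<lambda>i. vec_mat v a i - vec_mat v b i)" "vec_mat v (- a) = (\<lambda>i. - vec_mat v a i)"
  by (simp_all add: fun_eq_iff vec_mat_def algebra_simps sum.distrib sum_subtractf mat_def if_distrib
      if_distribR sum_negf cong: if_cong)

lemma dot_simps:
  "dot v (\<lambda>i. u i + w i) = dot v u + dot v w" "dot v (\<lambda>i. u i - w i) = dot v u - dot v w"
  "dot v (\<lambda>_. 0) = 0" "dot (\<lambda>_. 0) v = 0" "dot v (\<lambda>i. - u i) = - dot v u"
  "dot (\<lambda>i. u i + w i) v = dot u v + dot w v" "dot (\<lambda>i. u i - w i) v = dot u v - dot w v"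
  "dot (\<lambda>i. - u i) v = - dot u v"
  by (simp_all add: dot_def algebra_simps sum.distrib sum_subtractf sum_negf)

lemma unit_vec_simps [simp]:
  "unit_vec i i = 1" "i \<noteq> j \<Longrightarrow> unit_vec i j = 0" "dot v (unit_vec i) = v i" "dot (unit_vec i) v = v i"
  "mat_vec a (unit_vec j) = (\<lambda>i. entries a $ i $ j)" "vec_mat (unit_vec i) a = (\<lambda>j. entries a $ i $ j)"
  by (simp_all add: fun_eq_iff unit_vec_def dot_def mat_vec_def vec_mat_def if_distrib if_distribR cong: if_cong)

lemma rscale_simps [simp]: "rscale (rscale u c) d = rscale u (c * d)" "rscale u 1 = u"
  "lscale c (lscale d u) = lscale (c * d) u" "lscale 1 u = u" "rscale u 0 = (\<lambda>_. 0)"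
  "lscale 0 u = (\<lambda>_. 0)"
  by (simp_all add: rscale_def lscale_def mult.assoc)

text \<open>If \<open>d\<close> inverts \<open>1 + v u\<close> then \<open>1 - u d v\<close> inverts \<open>1 + u v\<close>, and if \<open>x\<close> inverts \<open>1 + u v\<close> then
  \<open>1 - v x u\<close> inverts \<open>1 + v u\<close>. This reduces questions on invertible matrices to questions on units of
  the coefficient ring.\<close>

lemma one_plus_outer_unit: "1 + outer u v \<in> unit_set \<longleftrightarrow> 1 + dot v u \<in> unit_set"
proof
  assume a: "1 + outer u v \<in> unit_set"
  let ?x = "unit_inv (1 + outer u v)" let ?d = "dot v (mat_vec ?x u)"
  have "?x + outer u v * ?x = 1" "?x + ?x * outer u v = 1"
    using unit_inv_right[OF a] unit_inv_left[OF a] by (simp_all only: distrib_left distrib_right mult_1_left mult_1_right)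
  then have "dot v (mat_vec (?x + outer u v * ?x) u) = dot v u" "dot v (mat_vec (?x + ?x * outer u v) u) = dot v u"
    by (simp_all add: mat_vec_simps)
  then have *: "?d + dot v u * ?d = dot v u" "?d + ?d * dot v u = dot v u"
    by (simp_all add: mat_vec_simps dot_simps mat_vec_mult mat_vec_outer mat_vec_rscale dot_rscale)
  then show "1 + dot v u \<in> unit_set"
    by (intro unit_setI[of "1 - ?d"]) (simp_all add: algebra_simps)
next
  assume a: "1 + dot v u \<in> unit_set"
  let ?d = "unit_inv (1 + dot v u)"
  let ?x = "outer (rscale u ?d) v"
  have d: "?d + dot v u * ?d = 1" "?d + ?d * dot v u = 1"
    using unit_inv_right[OF a] unit_inv_left[OF a] by (simp_all only: distrib_left distrib_right mult_1_left mult_1_right)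
  have "outer u v - ?x - outer u v * ?x = 0"
  proof (rule sqmatI)
    fix i j
    have "u i * v j = u i * (?d + dot v u * ?d) * v j" by (simp add: d)
    then show "entries (outer u v - ?x - outer u v * ?x) $ i $ j = entries 0 $ i $ j"
      unfolding mult_outer mat_vec_outer by (simp add: dot_rscale) (simp add: rscale_def algebra_simps)
  qed
  moreover have "outer u v - ?x - ?x * outer u v = 0"
  proof (rule sqmatI)
    fix i j
    have "u i * v j = u i * (?d + ?d * dot v u) * v j" by (simp add: d)
    then show "entries (outer u v - ?x - ?x * outer u v) $ i $ j = entries 0 $ i $ j"
      unfolding mult_outer mat_vec_outer by (simp add: dot_rscale) (simp add: rscale_def algebra_simps)
  qed
  ultimately show "1 + outer u v \<in> unit_set"
    by (intro unit_setI[of "1 - ?x"]) (simp_all add: algebra_simps)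
qed

lemma one_minus_outer_unit: "1 - outer u v \<in> unit_set \<longleftrightarrow> 1 - dot v u \<in> unit_set"
proof -
  have "1 - outer u v = 1 + outer u (\<lambda>i. - v i)" by (rule sqmatI) simp
  moreover have "1 - dot v u = 1 + dot (\<lambda>i. - v i) u" by (simp add: dot_simps)
  ultimately show ?thesis using one_plus_outer_unit[of u "\<lambda>i. - v i"] by (simp only:)
qed

lemma add_outer_unit:
  assumes "a \<in> unit_set"
  shows "a + outer u v \<in> unit_set \<longleftrightarrow> 1 + dot v (mat_vec (unit_inv a) u) \<in> unit_set"
proof -
  have "a + outer u v = a * (1 + outer (mat_vec (unit_inv a) u) v)"
    using assms by (simp add: distrib_left mult_outer mat_vec_mult[symmetric] mat_vec_simps)
  then show ?thesis
    using assms unit_mult[of a] unit_mult_cancel_left[of a] by (metis one_plus_outer_unit)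
qed

text \<open>Over a division ring this says that the rank is at most the number of elements of \<open>I\<close>. Taking
  the summands from the index type of the matrices makes induction on the rank an induction on
  finite sets.\<close>

definition factors_through :: "'m set \<Rightarrow> ('a::ring_1, 'm::finite) sqmat \<Rightarrow> bool" where
  "factors_through I c \<longleftrightarrow> (\<exists>x y. c = (\<Sum>i\<in>I. outer (x i) (y i)))"

lemma entries_sum: "entries (sum f I) $ i $ j = (\<Sum>k\<in>I. entries (f k :: ('a::ring_1, 'm::finite) sqmat) $ i $ j)"
  by (induction I rule: infinite_finite_induct) auto

lemma factors_through_UNIV: "factors_through UNIV c"
  unfolding factors_through_def
proof (intro exI)
  show "c = (\<Sum>i\<in>UNIV. outer (unit_vec i) (\<lambda>j. entries c $ i $ j))"
    by (rule sqmatI) (simp add: entries_sum unit_vec_def if_distrib if_distribR cong: if_cong)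
qed

context involution
begin

definition star_vec :: "('m \<Rightarrow> 'a) \<Rightarrow> 'm \<Rightarrow> 'a" where
  "star_vec u = (\<lambda>i. star (u i))"

lemma star_vec_star_vec [simp]: "star_vec (star_vec u) = u"
  by (simp add: star_vec_def)

lemma star_vec_unit_vec [simp]: "star_vec (unit_vec i) = unit_vec i"
  by (simp add: star_vec_def unit_vec_def if_distrib cong: if_cong)

lemma star_outer: "star_transpose star (outer u v) = outer (star_vec v) (star_vec u)"
  by (rule sqmatI) (simp add: star_vec_def)

lemma star_vec_mat_vec: "star_vec (mat_vec a u) = vec_mat (star_vec u) (star_transpose star a)"
  by (simp add: star_vec_def mat_vec_def vec_mat_def star_sum)

lemma star_vec_vec_mat: "star_vec (vec_mat v a) = mat_vec (star_transpose star a) (star_vec v)"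
  by (simp add: star_vec_def mat_vec_def vec_mat_def star_sum)

lemma star_dot: "star (dot v u) = dot (star_vec u) (star_vec v)"
  by (simp add: star_vec_def dot_def star_sum)

lemma star_vec_scale: "star_vec (rscale u c) = lscale (star c) (star_vec u)" "star_vec (lscale c u) = rscale (star_vec u) (star c)"
  by (simp_all add: star_vec_def rscale_def lscale_def)

end

section \<open>Hermitian matrices over a local ring\<close>

definition diag :: "('m \<Rightarrow> 'a) \<Rightarrow> ('a::ring_1, 'm::finite) sqmat" where
  "diag e = of_entries (\<chi> i j. if i = j then e i else 0)"

lemma entries_diag [simp]: "entries (diag e) $ i $ j = (if i = j then e i else 0)"
  by (simp add: diag_def)

text \<open>The principal block with index set \<open>F\<close>, completed by an identity matrix.\<close>

definition trunc :: "'m set \<Rightarrow> ('a::ring_1, 'm::finite) sqmat \<Rightarrow> ('a, 'm) sqmat" where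
  "trunc F a = of_entries (\<chi> i j. if i \<in> F \<and> j \<in> F then entries a $ i $ j else if i = j then 1 else 0)"

lemma entries_trunc [simp]: "entries (trunc F a) $ i $ j =
    (if i \<in> F \<and> j \<in> F then entries a $ i $ j else if i = j then 1 else 0)"
  by (simp add: trunc_def)

lemma trunc_UNIV: "trunc UNIV a = a"
  by (rule sqmatI) simp

lemma trunc_empty: "trunc {} a = 1"
  by (rule sqmatI) (simp add: mat_def)

lemma mat_vec_unit_inv_fixed:
  assumes "t \<in> unit_set" "mat_vec t u = u" shows "mat_vec (unit_inv t) u = u"
proof -
  have "mat_vec (unit_inv t) (mat_vec t u) = u" using assms(1) by (simp add: mat_vec_mult[symmetric] mat_vec_simps)
  then show ?thesis by (simp add: assms(2))
qed

text \<open>Bordering an invertible block by a row and a column leaves one condition on the new diagonal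
  entry: its Schur complement has to be a unit. The row and the column are two perturbations of rank
  one, and \<open>\<delta>\<close> depends on entries other than the new diagonal one.\<close>

lemma trunc_insert_unit:
  fixes a :: "('a::ring_1, 'm::finite) sqmat"
  assumes "trunc F a \<in> unit_set" "j \<notin> F"
  obtains \<delta> where "\<And>b. (\<And>i k. i \<noteq> j \<or> k \<noteq> j \<Longrightarrow> entries b $ i $ k = entries a $ i $ k) \<Longrightarrow>
    entries b $ j $ j - \<delta> \<in> unit_set \<Longrightarrow> trunc (insert j F) b \<in> unit_set"
proof -
  let ?t = "trunc F a"
  define row where "row = (\<lambda>k. if k \<in> F then entries a $ j $ k else 0)"
  define col where "col = (\<lambda>i. if i \<in> F then entries a $ i $ j else 0)"
  have e: "mat_vec ?t (unit_vec j) = unit_vec j"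
    using assms(2) unfolding unit_vec_simps by (auto simp: fun_eq_iff unit_vec_def)
  define t1 where "t1 = ?t + outer (unit_vec j) row"
  have t1: "t1 \<in> unit_set"
    unfolding t1_def add_outer_unit[OF assms(1)] mat_vec_unit_inv_fixed[OF assms(1) e]
    using assms(2) by (simp add: row_def)
  have "mat_vec t1 (unit_vec j) = unit_vec j"
    using assms(2) unfolding unit_vec_simps by (auto simp: fun_eq_iff unit_vec_def t1_def row_def)
  then have e1: "mat_vec (unit_inv t1) (unit_vec j) = unit_vec j"
    by (rule mat_vec_unit_inv_fixed[OF t1])
  have "trunc (insert j F) b \<in> unit_set"
    if b: "\<And>i k. i \<noteq> j \<or> k \<noteq> j \<Longrightarrow> entries b $ i $ k = entries a $ i $ k"
      and u: "entries b $ j $ j - - mat_vec (unit_inv t1) col j \<in> unit_set" for b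
  proof -
    let ?c = "\<lambda>i. col i + rscale (unit_vec j) (entries b $ j $ j - 1) i"
    have "mat_vec (unit_inv t1) ?c = (\<lambda>i. mat_vec (unit_inv t1) col i + mat_vec (unit_inv t1) (rscale (unit_vec j) (entries b $ j $ j - 1)) i)"
      by (simp add: mat_vec_def distrib_left sum.distrib)
    then have "dot (unit_vec j) (mat_vec (unit_inv t1) ?c) = mat_vec (unit_inv t1) col j + (entries b $ j $ j - 1)"
      by (simp only: mat_vec_rscale e1) (simp add: rscale_def)
    then have "1 + dot (unit_vec j) (mat_vec (unit_inv t1) ?c) \<in> unit_set"
      using u by (simp add: add.commute)
    then have "t1 + outer ?c (unit_vec j) \<in> unit_set"
      using add_outer_unit[OF t1] by blast
    moreover have "trunc (insert j F) b = t1 + outer ?c (unit_vec j)"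
      using assms(2) b by (intro sqmatI) (auto simp: t1_def row_def col_def unit_vec_def rscale_def)
    ultimately show ?thesis by simp
  qed
  then show ?thesis by (rule that)
qed

locale matrix_involution = local_involution star for star :: "'a::ring_1 \<Rightarrow> 'a" +
  fixes dim :: "'m::finite itself"
begin

abbreviation starA :: "('a, 'm) sqmat \<Rightarrow> ('a, 'm) sqmat" where
  "starA \<equiv> star_transpose star"

sublocale A: involution starA
  by unfold_locales (rule ring_involution_star_transpose[OF ring_involution])

lemma sym_entries: "s \<in> A.sym \<Longrightarrow> star (entries s $ i $ j) = entries s $ j $ i"
  using entries_star[of star s j i] by (simp add: A.sym_iff)

definition radical_mat :: "('a, 'm) sqmat \<Rightarrow> bool" where
  "radical_mat a \<longleftrightarrow> (\<forall>i j. entries a $ i $ j \<notin> unit_set)"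

lemma radical_mult:
  assumes "radical_mat a" shows "radical_mat (a * b)" "radical_mat (b * a)"
proof -
  have a: "entries a $ i $ j \<notin> unit_set" for i j using assms by (simp add: radical_mat_def)
  have "entries a $ i $ k * entries b $ k $ j \<notin> unit_set" for i j k
    by (rule nonunit_mult(1)[OF a])
  then show "radical_mat (a * b)"
    unfolding radical_mat_def entries_mult by (intro allI nonunit_sum)
  have "entries b $ i $ k * entries a $ k $ j \<notin> unit_set" for i j k
    by (rule nonunit_mult(2)[OF a])
  then show "radical_mat (b * a)"
    unfolding radical_mat_def entries_mult by (intro allI nonunit_sum)
qed

lemma radical_uminus: "radical_mat a \<Longrightarrow> radical_mat (- a)"
  by (simp add: radical_mat_def)

lemma one_plus_radical_unit:
  assumes "radical_mat a" shows "1 + a \<in> unit_set"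
proof -
  have "1 + (\<Sum>j\<in>F. outer (\<lambda>i. entries a $ i $ j) (unit_vec j)) \<in> unit_set" if "finite F" for F
    using that
  proof (induction F rule: finite_induct)
    case (insert j F)
    let ?t = "1 + (\<Sum>j\<in>F. outer (\<lambda>i. entries a $ i $ j) (unit_vec j))"
    have "mat_vec (unit_inv ?t) (\<lambda>i. entries a $ i $ j) j \<notin> unit_set"
      unfolding mat_vec_def using assms by (intro nonunit_sum nonunit_mult(2)) (simp add: radical_mat_def)
    then have "?t + outer (\<lambda>i. entries a $ i $ j) (unit_vec j) \<in> unit_set"
      unfolding add_outer_unit[OF insert.IH] by (simp add: unit_add_nonunit)
    then show ?case using insert.hyps by (simp add: ac_simps)
  qed simp
  moreover have "(\<Sum>j\<in>UNIV. outer (\<lambda>i. entries a $ i $ j) (unit_vec j)) = a"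
    by (rule sqmatI) (simp add: entries_sum unit_vec_def if_distrib cong: if_cong)
  ultimately show ?thesis by (metis finite)
qed

lemma one_minus_radical_unit: "radical_mat a \<Longrightarrow> 1 - a \<in> unit_set"
  using one_plus_radical_unit[of "- a"] radical_uminus by simp

text \<open>The diagonal entries are chosen one after the other. Each has to avoid one residue because of
  \<open>a\<close> and one because of \<open>b\<close>.\<close>

lemma diagonal_perturbation_on:
  fixes a b :: "('a, 'm) sqmat"
  assumes "trunc F a \<in> unit_set" "trunc F b \<in> unit_set" "F \<inter> F' = {}"
  shows "\<exists>e. range e \<subseteq> {0, 1, - 1} \<and> (\<forall>i. i \<notin> F' \<longrightarrow> e i = 0) \<and>
    trunc (F \<union> F') (a + diag e) \<in> unit_set \<and> trunc (F \<union> F') (b + diag e) \<in> unit_set"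
  using finite[of F'] assms
proof (induction F' rule: finite_induct)
  case empty
  have "a + diag (\<lambda>_. 0) = a" "b + diag (\<lambda>_. 0) = b" by (auto intro: sqmatI)
  then show ?case using empty by (intro exI[of _ "\<lambda>_. 0"]) simp
next
  case (insert j F')
  then obtain e where e: "range e \<subseteq> {0, 1, - 1}" "\<forall>i. i \<notin> F' \<longrightarrow> e i = 0"
    and u: "trunc (F \<union> F') (a + diag e) \<in> unit_set" "trunc (F \<union> F') (b + diag e) \<in> unit_set"
    by auto
  have j: "j \<notin> F \<union> F'" using insert by auto
  obtain da where da: "\<And>c. (\<And>i k. i \<noteq> j \<or> k \<noteq> j \<Longrightarrow> entries c $ i $ k = entries (a + diag e) $ i $ k) \<Longrightarrow>
    entries c $ j $ j - da \<in> unit_set \<Longrightarrow> trunc (insert j (F \<union> F')) c \<in> unit_set"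
    using trunc_insert_unit[OF u(1) j] by blast
  obtain db where db: "\<And>c. (\<And>i k. i \<noteq> j \<or> k \<noteq> j \<Longrightarrow> entries c $ i $ k = entries (b + diag e) $ i $ k) \<Longrightarrow>
    entries c $ j $ j - db \<in> unit_set \<Longrightarrow> trunc (insert j (F \<union> F')) c \<in> unit_set"
    using trunc_insert_unit[OF u(2) j] by blast
  obtain x where x: "x \<in> {0, 1, - 1}" "x - (da - entries a $ j $ j) \<in> unit_set"
    "x - (db - entries b $ j $ j) \<in> unit_set"
    by (rule avoid_two_residues)
  let ?e = "e(j := x)"
  have "trunc (insert j (F \<union> F')) (a + diag ?e) \<in> unit_set"
    using x(2) by (intro da) (auto simp: algebra_simps)
  moreover have "trunc (insert j (F \<union> F')) (b + diag ?e) \<in> unit_set"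
    using x(3) by (intro db) (auto simp: algebra_simps)
  moreover have "range ?e \<subseteq> {0, 1, - 1}" using e(1) x(1) by (auto simp: image_subset_iff)
  moreover have "\<forall>i. i \<notin> insert j F' \<longrightarrow> ?e i = 0" using e(2) by simp
  moreover have "F \<union> insert j F' = insert j (F \<union> F')" by simp
  ultimately show ?case by (intro exI[of _ ?e]) (simp only: simp_thms)
qed

lemma diag_sym:
  assumes "range e \<subseteq> {0, 1, - 1}" shows "diag e \<in> A.sym"
proof -
  have "e i \<in> {0, 1, - 1}" for i using assms by blast
  then have "star (e i) = e i" for i by (metis empty_iff insert_iff star_one star_uminus star_zero)
  then have "starA (diag e) = diag e" by (intro sqmatI) simp
  then show ?thesis by (simp add: A.sym_iff)
qed

lemma symmetric_perturbation:
  fixes a b :: "('a, 'm) sqmat"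
  obtains d where "d \<in> A.sym" "a + d \<in> unit_set" "b + d \<in> unit_set"
  using diagonal_perturbation_on[of "{}" a b UNIV] that diag_sym
  by (auto simp: trunc_empty trunc_UNIV)

lemma symmetric_perturbation_at:
  fixes a b :: "('a, 'm) sqmat"
  assumes "entries a $ i $ i \<in> unit_set" "entries b $ i $ i \<in> unit_set"
  obtains d where "d \<in> A.sym" "entries d $ i $ i = 0" "a + d \<in> unit_set" "b + d \<in> unit_set"
proof -
  have *: "trunc {i} c \<in> unit_set" if "entries c $ i $ i \<in> unit_set" for c :: "('a, 'm) sqmat"
  proof -
    have "trunc {i} c = 1 + outer (unit_vec i) (lscale (entries c $ i $ i - 1) (unit_vec i))"
      by (rule sqmatI) (auto simp: mat_def unit_vec_def lscale_def)
    then show ?thesis using that by (simp add: one_plus_outer_unit lscale_def)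
  qed
  have "{i} \<union> - {i} = UNIV" by auto
  then obtain e where "range e \<subseteq> {0, 1, - 1}" "e i = 0" "a + diag e \<in> unit_set" "b + diag e \<in> unit_set"
    using diagonal_perturbation_on[OF *[OF assms(1)] *[OF assms(2)], of "- {i}"]
    by (auto simp: trunc_UNIV)
  then show ?thesis using that[of "diag e"] diag_sym by simp
qed

text \<open>Here \<open>1 - r q\<close> is a unit for every \<open>q\<close>, so it suffices to write \<open>s\<close> as a sum of two symmetric
  units.\<close>

lemma linked_radical:
  assumes "r \<in> A.sym" "s \<in> A.sym" "radical_mat r"
  shows "A.linked r s"
proof -
  obtain d where "d \<in> A.sym" "0 + d \<in> unit_set" "- s + d \<in> unit_set"
    by (rule symmetric_perturbation)
  then show ?thesis
    using assms A.linked_two_step[of r s d] radical_mult one_minus_radical_unit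
    by (simp add: unit_diff_commute)
qed

lemma scalar_outer_unit:
  "1 - outer (unit_vec i) (lscale c (unit_vec i)) * q \<in> unit_set \<longleftrightarrow>
    1 - c * entries q $ i $ i \<in> unit_set"
  unfolding outer_mult one_minus_outer_unit vec_mat_lscale by (simp add: lscale_def)

lemma scalar_outer_sym: "star c = c \<Longrightarrow> outer (unit_vec i) (lscale c (unit_vec i)) \<in> A.sym"
  by (simp add: A.sym_iff star_outer star_vec_scale outer_rscale)

text \<open>The intermediate point \<open>q\<close> gets the diagonal entry \<open>x = 2 c\<inverse>\<close>: then \<open>1 - c x = - 1\<close>, and both
  \<open>x\<close> and \<open>x - s\<^bsub>ii\<^esub>\<close> are units, so that the other diagonal entries can be adjusted to make \<open>q\<close> and
  \<open>s - q\<close> invertible.\<close>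

lemma linked_coordinate_nonunit:
  assumes "c \<in> unit_set" "star c = c" "s \<in> A.sym" "entries s $ i $ i \<notin> unit_set"
  shows "A.linked (outer (unit_vec i) (lscale c (unit_vec i))) s"
proof -
  let ?r = "outer (unit_vec i) (lscale c (unit_vec i)) :: ('a, 'm) sqmat"
  let ?x = "2 * unit_inv c"
  let ?a = "outer (unit_vec i) (lscale ?x (unit_vec i)) :: ('a, 'm) sqmat"
  have x: "?x \<in> unit_set" by (intro unit_mult two_unit unit_inv_closed assms(1))
  moreover have "star ?x = ?x"
    using assms(1,2) by (simp add: star_unit_inv mult_2)
  ultimately have x: "?x \<in> unit_set" "star ?x = ?x" .
  have "entries ?a $ i $ i = ?x" by (simp add: lscale_def)
  then have "entries ?a $ i $ i \<in> unit_set" "entries (?a - s) $ i $ i \<in> unit_set"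
    using x assms(4) by (simp_all add: unit_add_nonunit)
  then obtain d where d: "d \<in> A.sym" "entries d $ i $ i = 0" "?a + d \<in> unit_set" "?a - s + d \<in> unit_set"
    by (rule symmetric_perturbation_at)
  show ?thesis
  proof (rule A.linked_two_step)
    show "?r \<in> A.sym" using assms(2) by (rule scalar_outer_sym)
    show "?a + d \<in> A.sym" using scalar_outer_sym[OF x(2)] d(1) by simp
    have "?a - s + d = - (s - (?a + d))" by (simp add: algebra_simps)
    then show "s - (?a + d) \<in> unit_set" using d(4) by (simp only: unit_uminus)
    have "c * entries (?a + d) $ i $ i = 2"
      using assms(1) d(2) by (simp add: lscale_def mult_2 distrib_left)
    then show "1 - ?r * (?a + d) \<in> unit_set"
      unfolding scalar_outer_unit by simp
    show "1 - ?r * s \<in> unit_set"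
      unfolding scalar_outer_unit using assms(4) by (intro unit_add_nonunit(2) nonunit_mult(2) unit_one)
  qed (use d assms in auto)
qed

text \<open>If \<open>s\<^bsub>ii\<^esub>\<close> is a unit, a first step to a diagonal matrix with the same entry at \<open>i\<close> leaves a
  remainder with entry \<open>0\<close> there, while \<open>r\<close> keeps its shape.\<close>

lemma linked_coordinate:
  assumes c: "c \<in> unit_set" "star c = c" and s: "s \<in> A.sym"
    and u: "1 - outer (unit_vec i) (lscale c (unit_vec i)) * s \<in> unit_set"
  shows "A.linked (outer (unit_vec i) (lscale c (unit_vec i))) s"
proof (cases "entries s $ i $ i \<in> unit_set")
  case False
  then show ?thesis using linked_coordinate_nonunit c s by blast
next
  case True
  let ?r = "outer (unit_vec i) (lscale c (unit_vec i)) :: ('a, 'm) sqmat"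
  define x where "x = entries s $ i $ i"
  have x: "x \<in> unit_set" "star x = x" using True s sym_entries by (auto simp: x_def)
  define q where "q = (1 + outer (unit_vec i) (lscale (x - 1) (unit_vec i)) :: ('a, 'm) sqmat)"
  have q: "q \<in> A.sym" "q \<in> unit_set" "entries q $ i $ i = x"
    using x scalar_outer_sym[of "x - 1" i]
    by (simp_all add: q_def one_plus_outer_unit dot_lscale mat_def lscale_def)
  have cx: "1 - c * x \<in> unit_set" using u unfolding scalar_outer_unit x_def .
  then have rq: "1 - ?r * q \<in> unit_set" by (simp add: scalar_outer_unit q)
  define c' where "c' = unit_inv (1 - c * x) * c"
  let ?r' = "outer (unit_vec i) (lscale c' (unit_vec i)) :: ('a, 'm) sqmat"
  have c': "c' \<in> unit_set" "star c' = c'"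
    using c cx sym_move[of c x] x by (auto simp: c'_def sym_iff)
  have "(1 - ?r * q) * ?r' = outer (\<lambda>k. unit_vec i k - rscale (unit_vec i) (c * x) k) (lscale c' (unit_vec i))"
  proof -
    have "mat_vec q (unit_vec i) i = x" using q(3) by simp
    then show ?thesis
      unfolding mult_outer mat_vec_simps mat_vec_mult mat_vec_outer by (simp add: dot_lscale del: unit_vec_simps(5))
  qed
  also have "\<dots> = outer (rscale (unit_vec i) (1 - c * x)) (lscale c' (unit_vec i))"
    by (simp add: rscale_def algebra_simps)
  also have "\<dots> = ?r" using cx by (simp add: outer_rscale c'_def)
  finally have "unit_inv (1 - ?r * q) * ((1 - ?r * q) * ?r') = unit_inv (1 - ?r * q) * ?r" by simp
  then have r': "?r' = unit_inv (1 - ?r * q) * ?r" using rq by simp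
  show ?thesis
  proof (rule A.linked.step)
    show "A.linked ?r q"
      using rq q scalar_outer_sym[OF c(2)] by (intro A.linked.unit)
    have "A.linked ?r' (s - q)"
      using c' s q by (intro linked_coordinate_nonunit) (simp_all add: x_def nonunit_zero)
    then show "A.linked (unit_inv (1 - ?r * q) * ?r) (s - q)" by (simp only: r')
  qed (rule rq)
qed

lemma rank_one_sym: "star c = c \<Longrightarrow> outer (rscale u c) (star_vec u) \<in> A.sym"
  by (simp add: A.sym_iff star_outer star_vec_scale outer_rscale)

text \<open>A base change maps a column with a unit entry to a standard unit column; a column without
  unit entries makes \<open>r\<close> vanish modulo the radical.\<close>

lemma linked_rank_one:
  assumes c: "c \<in> unit_set" "star c = c" and s: "s \<in> A.sym"
    and u: "1 - outer (rscale u c) (star_vec u) * s \<in> unit_set"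
  shows "A.linked (outer (rscale u c) (star_vec u)) s"
proof (cases "\<exists>i. u i \<in> unit_set")
  case False
  then have "radical_mat (outer (rscale u c) (star_vec u))"
    by (simp add: radical_mat_def rscale_def nonunit_mult(1))
  then show ?thesis using linked_radical rank_one_sym c s by blast
next
  case True
  then obtain i where i: "u i \<in> unit_set" ..
  let ?r = "outer (rscale u c) (star_vec u)"
  define g where "g = 1 + outer (\<lambda>k. unit_vec i k - u k) (lscale (unit_inv (u i)) (unit_vec i))"
  have g: "g \<in> unit_set"
    using i by (simp add: g_def one_plus_outer_unit dot_lscale right_diff_distrib)
  have gu: "mat_vec g u = unit_vec i"
    using i by (simp add: g_def mat_vec_simps mat_vec_outer dot_lscale)
  have "g * ?r * starA g = outer (rscale (mat_vec g u) c) (star_vec (mat_vec g u))"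
    by (simp add: mult_outer outer_mult mat_vec_rscale star_vec_mat_vec)
  then have gr: "g * ?r * starA g = outer (unit_vec i) (lscale c (unit_vec i))"
    by (simp add: gu outer_rscale)
  show ?thesis
  proof (rule A.linked.conj[OF _ g])
    let ?s = "starA (unit_inv g) * s * unit_inv g"
    have "g * (1 - ?r * s) * unit_inv g = 1 - g * ?r * (starA g * starA (unit_inv g)) * s * unit_inv g"
      using g by (simp add: algebra_simps flip: A.star_mult)
    also have "\<dots> = 1 - g * ?r * starA g * ?s" by (simp add: mult.assoc)
    finally have "1 - g * ?r * starA g * ?s \<in> unit_set"
      using g u by (metis unit_mult unit_inv_closed)
    then show "A.linked (g * ?r * starA g) ?s"
      unfolding gr using s c by (intro linked_coordinate) auto
  qed (use rank_one_sym c s in auto)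
qed

text \<open>The reduced matrix \<open>c'\<close> has the form \<open>c q\<close> and is annihilated by \<open>w\<close> from the left. Hence
  \<open>c' = p c q\<close> for every \<open>p\<close> of the form \<open>1 - x' w\<close>, and \<open>p\<close> can be chosen to annihilate one of the
  columns in a factorization of \<open>c\<close>, namely one whose product with \<open>w\<close> is a unit.\<close>

lemma wedderburn_rank_reduction:
  fixes c :: "('a, 'm) sqmat"
  assumes "factors_through I c" "dot w (mat_vec c n) \<in> unit_set"
  obtains k where "k \<in> I"
    "factors_through (I - {k}) (c - outer (rscale (mat_vec c n) (unit_inv (dot w (mat_vec c n)))) (vec_mat w c))"
proof -
  obtain x y where c: "c = (\<Sum>i\<in>I. outer (x i) (y i))"
    using assms(1) by (auto simp: factors_through_def)
  have expand: "p * c * q = (\<Sum>i\<in>I. outer (mat_vec p (x i)) (vec_mat (y i) q))" for p q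
    unfolding c by (simp add: sum_distrib_left sum_distrib_right mult_outer outer_mult)
  let ?\<epsilon> = "unit_inv (dot w (mat_vec c n))"
  let ?c = "c - outer (rscale (mat_vec c n) ?\<epsilon>) (vec_mat w c)"
  let ?q = "1 - outer (rscale n ?\<epsilon>) (vec_mat w c)"
  have cq: "?c = c * ?q" by (simp add: right_diff_distrib mult_outer mat_vec_rscale)
  have wc: "vec_mat w ?c = (\<lambda>_. 0)"
    using assms(2) by (simp add: vec_mat_simps vec_mat_outer dot_rscale)
  have "mat_vec c n = (\<lambda>j. \<Sum>i\<in>I. x i j * dot (y i) n)"
  proof
    fix j
    have "mat_vec c n j = (\<Sum>l\<in>UNIV. \<Sum>i\<in>I. x i j * (y i l * n l))"
      by (simp add: mat_vec_def c entries_sum sum_distrib_right mult.assoc)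
    also have "\<dots> = (\<Sum>i\<in>I. x i j * dot (y i) n)"
      by (subst sum.swap) (simp add: dot_def sum_distrib_left)
    finally show "mat_vec c n j = (\<Sum>i\<in>I. x i j * dot (y i) n)" .
  qed
  then have "dot w (mat_vec c n) = (\<Sum>l\<in>UNIV. \<Sum>i\<in>I. w l * (x i l * dot (y i) n))"
    by (simp add: dot_def[of w] sum_distrib_left)
  also have "\<dots> = (\<Sum>i\<in>I. dot w (x i) * dot (y i) n)"
    by (subst sum.swap) (simp add: dot_def[of w] sum_distrib_right mult.assoc)
  finally obtain k where k: "k \<in> I" "dot w (x k) \<in> unit_set"
    using assms(2) nonunit_sum[of I "\<lambda>i. dot w (x i) * dot (y i) n"] nonunit_mult(1) by metis
  let ?p = "1 - outer (rscale (x k) (unit_inv (dot w (x k)))) w"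
  have "?p * ?c = ?c" by (simp add: left_diff_distrib outer_mult wc) (rule sqmatI, simp)
  then have "?c = ?p * c * ?q" unfolding cq by (simp only: mult.assoc)
  also have "\<dots> = (\<Sum>i\<in>I. outer (mat_vec ?p (x i)) (vec_mat (y i) ?q))" by (rule expand)
  also have "\<dots> = (\<Sum>i\<in>I - {k}. outer (mat_vec ?p (x i)) (vec_mat (y i) ?q))"
  proof (rule sum.mono_neutral_right)
    have "mat_vec ?p (x k) = (\<lambda>_. 0)"
      using k(2) by (simp add: mat_vec_simps mat_vec_outer)
    then show "\<forall>i\<in>I - (I - {k}). outer (mat_vec ?p (x i)) (vec_mat (y i) ?q) = 0"
      by (auto intro: sqmatI)
  qed auto
  finally have "factors_through (I - {k}) ?c"
    unfolding factors_through_def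
    by (intro exI[of _ "\<lambda>i. mat_vec ?p (x i)"] exI[of _ "\<lambda>i. vec_mat (y i) ?q"])
  then show ?thesis using k(1) that by blast
qed

definition form :: "('a, 'm) sqmat \<Rightarrow> ('m \<Rightarrow> 'a) \<Rightarrow> ('m \<Rightarrow> 'a) \<Rightarrow> 'a" where
  "form f v w = dot (star_vec v) (mat_vec f w)"

lemma star_form: "f \<in> A.sym \<Longrightarrow> star (form f v w) = form f w v"
  by (simp add: form_def star_dot star_vec_mat_vec dot_vec_mat A.sym_iff)

lemma form_shift: "form f (\<lambda>i. v i + rscale w a i) (\<lambda>i. v i + rscale w a i) =
    form f v v + form f v w * a + star a * form f w v + star a * form f w w * a"
proof -
  have 1: "mat_vec f (\<lambda>i. v i + rscale w a i) = (\<lambda>i. mat_vec f v i + rscale (mat_vec f w) a i)"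
    by (simp add: mat_vec_rscale[symmetric]) (simp add: mat_vec_def distrib_left sum.distrib)
  have 2: "star_vec (\<lambda>i. v i + rscale w a i) = (\<lambda>i. star_vec v i + lscale (star a) (star_vec w) i)"
    by (simp add: star_vec_def rscale_def lscale_def)
  show ?thesis
    unfolding form_def 1 2 by (simp add: dot_simps dot_lscale dot_rscale mult.assoc distrib_left)
qed

text \<open>If the diagonal entries at \<open>i\<close> and \<open>j\<close> vanish modulo the radical and the entry at \<open>(i, j)\<close> is a
  unit, a combination of the two unit columns has value \<open>2\<close> modulo the radical.\<close>

lemma form_value_unit:
  assumes "f \<in> A.sym" "\<not> radical_mat f"
  obtains v where "form f v v \<in> unit_set"
proof -
  obtain i j where ij: "entries f $ i $ j \<in> unit_set" using assms(2) by (auto simp: radical_mat_def)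
  have d: "form f (unit_vec k) (unit_vec l) = entries f $ k $ l" for k l by (simp add: form_def)
  show ?thesis
  proof (cases "entries f $ i $ i \<in> unit_set \<or> entries f $ j $ j \<in> unit_set")
    case True
    then show ?thesis using that[of "unit_vec i"] that[of "unit_vec j"] by (auto simp: d)
  next
    case False
    let ?a = "unit_inv (entries f $ i $ j)"
    let ?v = "\<lambda>k. unit_vec i k + rscale (unit_vec j) ?a k"
    have "star ?a * entries f $ j $ i = star (entries f $ i $ j * ?a)"
      using sym_entries[OF assms(1), of i j] by simp
    then have *: "star ?a * entries f $ j $ i = 1" using ij by simp
    have "form f ?v ?v = 2 + (entries f $ i $ i + star ?a * entries f $ j $ j * ?a)"
      unfolding form_shift d * using ij by (simp add: algebra_simps)
    moreover have "entries f $ i $ i + star ?a * entries f $ j $ j * ?a \<notin> unit_set"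
      using False by (intro nonunit_add nonunit_mult) auto
    ultimately have "form f ?v ?v \<in> unit_set" using two_unit unit_add_nonunit(1) by metis
    then show ?thesis by (rule that)
  qed
qed

end

context matrix_involution
begin

text \<open>If \<open>s\<close> takes a unit value at \<open>v\<close>, the form \<open>s - rank_one_part s v\<close> agrees with \<open>s\<close> on the orthogonal complement of \<open>v\<close> and
  has \<open>v\<close> in its kernel.\<close>

definition rank_one_part :: "('a, 'm) sqmat \<Rightarrow> ('m \<Rightarrow> 'a) \<Rightarrow> ('a, 'm) sqmat" where
  "rank_one_part s v = outer (rscale (mat_vec s v) (unit_inv (form s v v))) (star_vec (mat_vec s v))"

lemma star_vec_mat_vec_sym: "s \<in> A.sym \<Longrightarrow> star_vec (mat_vec s v) = vec_mat (star_vec v) s"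
  by (simp add: star_vec_mat_vec A.sym_iff)

lemma rank_one_part:
  assumes "s \<in> A.sym" "form s v v \<in> unit_set"
  shows "rank_one_part s v \<in> A.sym" "star (unit_inv (form s v v)) = unit_inv (form s v v)"
    "mat_vec (rank_one_part s v) v = mat_vec s v" "vec_mat (star_vec v) (rank_one_part s v) = vec_mat (star_vec v) s"
    "dot (star_vec (mat_vec s v)) v = form s v v"
proof -
  show e: "star (unit_inv (form s v v)) = unit_inv (form s v v)"
    using assms by (simp add: star_unit_inv star_form)
  show "rank_one_part s v \<in> A.sym"
    unfolding rank_one_part_def by (rule rank_one_sym[OF e])
  show d: "dot (star_vec (mat_vec s v)) v = form s v v"
    by (simp add: star_vec_mat_vec_sym[OF assms(1)] dot_vec_mat form_def)
  show "mat_vec (rank_one_part s v) v = mat_vec s v"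
    using assms(2) by (simp add: rank_one_part_def mat_vec_outer d)
  show "vec_mat (star_vec v) (rank_one_part s v) = vec_mat (star_vec v) s"
    using assms by (simp add: rank_one_part_def vec_mat_outer dot_rscale flip: form_def)
      (simp add: star_vec_mat_vec_sym)
qed

lemma rank_one_part_reduces:
  assumes "s \<in> A.sym" "form s v v \<in> unit_set" "factors_through I s"
  obtains k where "k \<in> I" "factors_through (I - {k}) (s - rank_one_part s v)"
  using wedderburn_rank_reduction[OF assms(3), of "star_vec v" v] assms(2) that
  unfolding rank_one_part_def star_vec_mat_vec_sym[OF assms(1)] form_def by blast

text \<open>Induction on the rank of \<open>r\<close>. Let \<open>f\<close> be the part of rank one at \<open>v\<close> and \<open>p'\<close> a solution for
  \<open>r - f\<close>. Since \<open>r - f\<close> annihilates \<open>v\<close>, passing to \<open>p = p' + v x v\<^sup>*\<close> does not change \<open>(r - f) p\<close>, so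
  \<open>1 - r p\<close> and \<open>p - s\<close> are perturbations of rank one of the invertible matrices \<open>1 - (r - f) p'\<close> and
  \<open>p' - s\<close>. Each of the two is invertible if \<open>x\<close> avoids one residue, and \<open>{0, 1, -1}\<close> contains such
  an \<open>x\<close>.\<close>

lemma common_unit:
  assumes "r \<in> A.sym" "s \<in> A.sym"
  shows "\<exists>p\<in>A.sym. p - s \<in> unit_set \<and> 1 - r * p \<in> unit_set"
proof -
  have "\<exists>p\<in>A.sym. p - s \<in> unit_set \<and> 1 - r * p \<in> unit_set"
    if "r \<in> A.sym" "factors_through I r" for I r
    using finite[of I] that
  proof (induction I arbitrary: r rule: finite_psubset_induct)
    case (psubset I)
    show ?case
    proof (cases "radical_mat r")
      case True
      then have "1 - r * (s + 1) \<in> unit_set" using radical_mult one_minus_radical_unit by blast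
      then show ?thesis using assms(2) by (intro bexI[of _ "s + 1"]) auto
    next
      case False
      then obtain v where v: "form r v v \<in> unit_set"
        using form_value_unit psubset.prems(1) by blast
      define f where "f = rank_one_part r v"
      note f = rank_one_part[OF psubset.prems(1) v, folded f_def]
      obtain k where k: "k \<in> I" "factors_through (I - {k}) (r - f)"
        using rank_one_part_reduces[OF psubset.prems(1) v psubset.prems(2)] unfolding f_def by blast
      have "I - {k} \<subset> I" using k(1) by blast
      then obtain p' where p': "p' \<in> A.sym" "p' - s \<in> unit_set" "1 - (r - f) * p' \<in> unit_set"
        using psubset.IH[OF _ _ k(2)] psubset.prems(1) f(1) by auto
      define u where "u = mat_vec r v"
      define \<alpha> where "\<alpha> = form r v v"
      define \<epsilon> where "\<epsilon> = unit_inv \<alpha>"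
      define M where "M = 1 - (r - f) * p'"
      define N where "N = p' - s"
      have MN: "M \<in> unit_set" "N \<in> unit_set" using p' by (auto simp: M_def N_def)
      have \<alpha>: "\<alpha> \<in> unit_set" "\<alpha> * \<epsilon> = 1" "\<epsilon> * \<alpha> = 1" using v by (auto simp: \<alpha>_def \<epsilon>_def)
      have r'v: "mat_vec (r - f) v = (\<lambda>_. 0)" "vec_mat (star_vec v) (r - f) = (\<lambda>_. 0)"
        using f(3,4) by (simp_all add: mat_vec_simps vec_mat_simps)
      have "vec_mat (star_vec v) ((r - f) * p') = (\<lambda>_. 0)"
        unfolding vec_mat_mult r'v by (simp add: vec_mat_def)
      then have "vec_mat (star_vec v) M = star_vec v" unfolding M_def vec_mat_simps(2,4) by simp
      then have "vec_mat (star_vec v) (M * unit_inv M) = vec_mat (star_vec v) (unit_inv M)" by (simp add: vec_mat_mult)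
      then have vM: "vec_mat (star_vec v) (unit_inv M) = star_vec v" using MN by (simp add: vec_mat_simps)
      define y where "y = mat_vec (unit_inv M) u"
      define \<beta> where "\<beta> = dot (star_vec u) (mat_vec p' y)"
      define \<eta> where "\<eta> = dot (star_vec v) (mat_vec (unit_inv N) v)"
      have vy: "dot (star_vec v) y = \<alpha>"
        unfolding y_def dot_vec_mat[symmetric] vM by (simp add: u_def \<alpha>_def form_def)
      \<comment> \<open>If \<open>\<eta>\<close> is not a unit, \<open>1 + \<eta> x\<close> is a unit for every \<open>x\<close>, and the value \<open>0\<close> is arbitrary.\<close>
      define \<delta> where "\<delta> = (if \<eta> \<in> unit_set then - unit_inv \<eta> else 0)"
      obtain x where x: "x \<in> {0, 1, - 1}" "x - \<epsilon> * (1 - \<beta> * \<epsilon>) \<in> unit_set" "x - \<delta> \<in> unit_set"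
        by (rule avoid_two_residues)
      have sx: "star x = x" using x(1) by auto
      define p where "p = p' + outer (rscale v x) (star_vec v)"
      have "p \<in> A.sym" using p'(1) rank_one_sym[OF sx] by (simp add: p_def)
      moreover have "p - s \<in> unit_set"
      proof -
        have "1 + \<eta> * x \<in> unit_set"
        proof (cases "\<eta> \<in> unit_set")
          case True
          then have "1 + \<eta> * x = \<eta> * (x - \<delta>)" by (simp add: \<delta>_def distrib_left)
          then show ?thesis using True x(3) by simp
        next
          case False
          then show ?thesis using nonunit_mult(1) unit_add_nonunit(1)[OF unit_one] by blast
        qed
        then have "N + outer (rscale v x) (star_vec v) \<in> unit_set"
          unfolding add_outer_unit[OF MN(2)] by (simp add: mat_vec_rscale dot_rscale \<eta>_def)
        then show ?thesis by (simp add: p_def N_def algebra_simps)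
      qed
      moreover have "1 - r * p \<in> unit_set"
      proof -
        have "(r - f) * p = (r - f) * p'"
          unfolding p_def distrib_left mult_outer mat_vec_rscale r'v
          by (rule sqmatI) (simp add: rscale_def)
        then have "1 - r * p = M - f * p" by (simp add: M_def algebra_simps)
        also have "\<dots> = M + outer (rscale u (- \<epsilon>)) (vec_mat (star_vec u) p)"
          unfolding f_def rank_one_part_def outer_mult u_def[symmetric] \<alpha>_def[symmetric] \<epsilon>_def[symmetric]
          by (rule sqmatI) (simp add: rscale_def)
        finally have eq: "1 - r * p = M + outer (rscale u (- \<epsilon>)) (vec_mat (star_vec u) p)" .
        have "mat_vec p y = (\<lambda>i. mat_vec p' y i + rscale v (x * \<alpha>) i)"
          unfolding p_def mat_vec_simps mat_vec_outer vy by simp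
        then have "dot (star_vec u) (mat_vec p y) = \<beta> + \<alpha> * (x * \<alpha>)"
          using f(5) by (simp add: dot_simps dot_rscale \<beta>_def u_def \<alpha>_def)
        then have "1 + dot (vec_mat (star_vec u) p) (mat_vec (unit_inv M) (rscale u (- \<epsilon>))) =
            1 - (\<beta> + \<alpha> * (x * \<alpha>)) * \<epsilon>"
          by (simp add: mat_vec_rscale dot_rscale dot_vec_mat y_def)
        also have "\<dots> = 1 - \<beta> * \<epsilon> - \<alpha> * x"
          using \<alpha> by (simp add: distrib_right mult.assoc)
        also have "\<dots> = - (\<alpha> * (x - \<epsilon> * (1 - \<beta> * \<epsilon>)))"
          using \<alpha> by (simp add: right_diff_distrib mult.assoc[symmetric])
        finally have "1 + dot (vec_mat (star_vec u) p) (mat_vec (unit_inv M) (rscale u (- \<epsilon>))) =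
          - (\<alpha> * (x - \<epsilon> * (1 - \<beta> * \<epsilon>)))" .
        moreover have "- (\<alpha> * (x - \<epsilon> * (1 - \<beta> * \<epsilon>))) \<in> unit_set"
          using \<alpha>(1) x(2) by simp
        ultimately show ?thesis unfolding eq add_outer_unit[OF MN(1)] by (simp only:)
      qed
      ultimately show ?thesis by blast
    qed
  qed
  then show ?thesis using assms(1) factors_through_UNIV by blast
qed

section \<open>Generation by Bruhat elements\<close>

lemma lower_in_generated:
  fixes \<Gamma> :: "(('a, 'm) sqmat, 2) sqmat set"
  assumes mult: "\<And>g h. g \<in> \<Gamma> \<Longrightarrow> h \<in> \<Gamma> \<Longrightarrow> g * h \<in> \<Gamma>"
    and w: "bruhat_w \<in> \<Gamma>" and h: "\<And>t. t \<in> unit_set \<Longrightarrow> bruhat_h starA t \<in> \<Gamma>"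
    and u: "\<And>r. r \<in> A.sym \<Longrightarrow> bruhat_u r \<in> \<Gamma>"
    and r: "r \<in> A.sym"
  shows "mat2 1 0 r 1 \<in> \<Gamma>"
proof -
  have "bruhat_w * bruhat_u (- r) * (bruhat_w * bruhat_h starA (- 1)) \<in> \<Gamma>"
    using r by (intro mult w u h) auto
  also have "bruhat_w * bruhat_u (- r) * (bruhat_w * bruhat_h starA (- 1)) = mat2 1 0 r 1"
    by (simp add: bruhat_w_def bruhat_u_def bruhat_h_def mat2_mult unit_inv_uminus)
  finally show ?thesis .
qed

text \<open>Induction on the rank of the lower left entry \<open>c\<close>. If \<open>c\<close> vanishes modulo the radical, \<open>d\<close> is a
  unit, and the matrix is a product of an upper unipotent, a diagonal and a lower unipotent one.
  Otherwise the hermitian matrix \<open>c d\<^sup>*\<close> can be made nonzero modulo the radical by adding to \<open>d\<close> a matrix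
  \<open>c p\<close> with \<open>p\<close> symmetric. If \<open>v\<close> is a column at which it takes a unit value \<open>\<alpha>\<close>, multiplication by
  a lower unipotent matrix replaces \<open>c\<close> by \<open>c - d r\<close>, where \<open>r = (v\<^sup>* c)\<^sup>* \<alpha>\<inverse> (v\<^sup>* c)\<close>. Because of
  \<open>d c\<^sup>* = c d\<^sup>*\<close> this is the Wedderburn reduction of \<open>c\<close> at the row \<open>v\<^sup>*\<close> and the column \<open>d\<^sup>* v\<close>.\<close>

lemma SL_star_generated:
  fixes \<Gamma> :: "(('a, 'm) sqmat, 2) sqmat set"
  assumes mult: "\<And>g h. g \<in> \<Gamma> \<Longrightarrow> h \<in> \<Gamma> \<Longrightarrow> g * h \<in> \<Gamma>"
    and w: "bruhat_w \<in> \<Gamma>" and h: "\<And>t. t \<in> unit_set \<Longrightarrow> bruhat_h starA t \<in> \<Gamma>"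
    and u: "\<And>r. r \<in> A.sym \<Longrightarrow> bruhat_u r \<in> \<Gamma>"
  shows "carrier (SL_star starA) \<subseteq> \<Gamma>"
proof -
  interpret S: group "SL_star starA" by (rule group_SL_star[OF A.ring_involution])
  have lower: "mat2 1 0 r 1 \<in> \<Gamma>" if "r \<in> A.sym" for r
    using lower_in_generated[of \<Gamma> r] assms that by blast
  have SL_mult: "x * y \<in> carrier (SL_star starA)"
    if "x \<in> carrier (SL_star starA)" "y \<in> carrier (SL_star starA)" for x y
    using S.m_closed[OF that] by simp
  have SL_lower: "mat2 1 0 r 1 \<in> carrier (SL_star starA)" if "r \<in> A.sym" for r
    using that by (simp add: A.SL_star_mat2_iff A.sym_iff)
  have base: "mat2 a b c d \<in> \<Gamma>"
    if x: "mat2 a b c d \<in> carrier (SL_star starA)" and c: "radical_mat c" for a b c d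
  proof -
    note SL = x[unfolded A.SL_star_mat2_iff]
    have 1: "a * starA d = 1 + b * starA c" "starA a * d = 1 + starA c * b"
      using SL by (simp_all add: algebra_simps)
    have "radical_mat (starA c)" using c by (simp add: radical_mat_def)
    then have U: "a * starA d \<in> unit_set" "starA a * d \<in> unit_set"
      unfolding 1 using radical_mult one_plus_radical_unit by blast+
    have "starA (a * starA d) \<in> unit_set" using U(1) by (simp only: A.star_unit)
    then have U1: "d * starA a \<in> unit_set" by simp
    have d: "d \<in> unit_set"
    proof -
      let ?l = "unit_inv (starA a * d) * starA a" and ?r = "starA a * unit_inv (d * starA a)"
      have l: "?l * d = 1" using U(2) by (simp add: mult.assoc)
      have r: "d * ?r = 1" using U1 by (simp flip: mult.assoc)
      have "?l = ?l * (d * ?r)" by (simp only: r mult_1_right)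
      also have "\<dots> = ?r" by (simp only: mult.assoc[symmetric] l mult_1_left)
      finally show ?thesis using l r by (metis unit_setI)
    qed
    let ?d = "unit_inv d" let ?t = "unit_inv (starA d)"
    have t: "?t \<in> unit_set" using d by simp
    have r: "?d * c = starA c * ?t"
    proof -
      have "?d * (c * starA d) * ?t = ?d * (d * starA c) * ?t" using SL by simp
      then show ?thesis using d by (simp add: mult.assoc)
    qed
    then have rs: "?d * c \<in> A.sym" using d by (simp add: A.sym_iff A.star_unit_inv)
    have p: "b * ?d = ?t * starA b"
    proof -
      have "?t * (starA b * d) * ?d = ?t * (starA d * b) * ?d" using SL by simp
      then show ?thesis using d by (simp add: mult.assoc)
    qed
    then have ps: "b * ?d \<in> A.sym" using d by (simp add: A.sym_iff A.star_unit_inv)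
    have "a * starA d * ?t = (1 + b * starA c) * ?t" using 1 by simp
    then have a: "a = ?t + b * (?d * c)" using d by (simp add: mult.assoc distrib_right r)
    have "bruhat_u (b * ?d) * bruhat_h starA ?t * mat2 1 0 (?d * c) 1 \<in> \<Gamma>"
      using ps rs t by (intro mult u h lower)
    also have "bruhat_u (b * ?d) * bruhat_h starA ?t * mat2 1 0 (?d * c) 1 = mat2 a b c d"
      using d a by (simp add: bruhat_u_def bruhat_h_def mat2_mult mat2_eq_iff mult.assoc A.star_unit_inv)
    finally show ?thesis .
  qed
  have "mat2 a b c d \<in> \<Gamma>"
    if "mat2 a b c d \<in> carrier (SL_star starA)" "factors_through I c" for I a b c d
    using finite[of I] that
  proof (induction I arbitrary: a b c d rule: finite_psubset_induct)
    case (psubset I)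
    have step: "mat2 a b c d \<in> \<Gamma>"
      if x: "mat2 a b c d \<in> carrier (SL_star starA)" and n: "\<not> radical_mat (c * starA d)" for b d
    proof -
      have cd: "c * starA d = d * starA c" using x by (simp add: A.SL_star_mat2_iff)
      then have s: "c * starA d \<in> A.sym" by (simp add: A.sym_iff)
      obtain v where v: "form (c * starA d) v v \<in> unit_set" using form_value_unit[OF s n] .
      define \<epsilon> where "\<epsilon> = unit_inv (form (c * starA d) v v)"
      have \<epsilon>: "star \<epsilon> = \<epsilon>" using v s by (simp add: \<epsilon>_def star_unit_inv star_form)
      define r where "r = outer (rscale (star_vec (vec_mat (star_vec v) c)) \<epsilon>) (vec_mat (star_vec v) c)"
      have r: "r \<in> A.sym" using rank_one_sym[OF \<epsilon>, of "star_vec (vec_mat (star_vec v) c)"] by (simp add: r_def)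
      have "dot (star_vec v) (mat_vec c (mat_vec (starA d) v)) \<in> unit_set"
        using v by (simp add: form_def mat_vec_mult)
      from wedderburn_rank_reduction[OF psubset.prems(2) this]
      obtain k where k: "k \<in> I"
        "factors_through (I - {k}) (c - outer (rscale (mat_vec (c * starA d) v) \<epsilon>) (vec_mat (star_vec v) c))"
        unfolding \<epsilon>_def form_def mat_vec_mult by blast
      have "d * r = outer (rscale (mat_vec (c * starA d) v) \<epsilon>) (vec_mat (star_vec v) c)"
        unfolding cd by (simp add: r_def mult_outer mat_vec_rscale mat_vec_mult star_vec_vec_mat)
      then have k2: "factors_through (I - {k}) (c - d * r)" using k(2) by simp
      have "mat2 a b c d * mat2 1 0 (- r) 1 \<in> carrier (SL_star starA)"
        using r by (intro SL_mult SL_lower x) auto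
      then have m: "mat2 (a - b * r) b (c - d * r) d \<in> carrier (SL_star starA)"
        by (simp add: mat2_mult)
      have "I - {k} \<subset> I" using k(1) by blast
      from psubset.IH[OF this m k2] have "mat2 (a - b * r) b (c - d * r) d * mat2 1 0 r 1 \<in> \<Gamma>"
        by (intro mult lower r)
      then show ?thesis by (simp add: mat2_mult)
    qed
    show ?case
    proof (cases "radical_mat c")
      case True
      then show ?thesis using base psubset.prems(1) by blast
    next
      case False
      show ?thesis
      proof (cases "radical_mat (c * starA d)")
        case False
        then show ?thesis using step psubset.prems(1) by blast
      next
        case True
        obtain i j where ij: "entries c $ i $ j \<in> unit_set"
          using \<open>\<not> radical_mat c\<close> by (auto simp: radical_mat_def)
        define p where "p = (outer (unit_vec j) (unit_vec j) :: ('a, 'm) sqmat)"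
        have p: "p \<in> A.sym" by (simp add: p_def A.sym_iff star_outer)
        have "mat2 a b c d * bruhat_u p \<in> carrier (SL_star starA)"
          using p by (intro SL_mult psubset.prems(1) A.bruhat_closed)
        then have m: "mat2 a (a * p + b) c (c * p + d) \<in> carrier (SL_star starA)"
          by (simp add: bruhat_u_def mat2_mult)
        have "c * starA (c * p + d) = c * p * starA c + c * starA d"
          using p by (simp add: A.sym_iff distrib_left mult.assoc)
        also have "c * p * starA c = outer (\<lambda>k. entries c $ k $ j) (\<lambda>k. star (entries c $ k $ j))"
          by (simp add: p_def mult_outer outer_mult)
        finally have "entries (c * starA (c * p + d)) $ i $ i =
            entries c $ i $ j * star (entries c $ i $ j) + entries (c * starA d) $ i $ i"
          by simp
        moreover have "entries (c * starA d) $ i $ i \<notin> unit_set"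
          using True unfolding radical_mat_def by blast
        moreover have "entries c $ i $ j * star (entries c $ i $ j) \<in> unit_set"
          using ij by simp
        ultimately have "entries (c * starA (c * p + d)) $ i $ i \<in> unit_set"
          using unit_add_nonunit(1) by metis
        then have "\<not> radical_mat (c * starA (c * p + d))" unfolding radical_mat_def by blast
        with step m have "mat2 a (a * p + b) c (c * p + d) \<in> \<Gamma>" by blast
        then have "mat2 a (a * p + b) c (c * p + d) * bruhat_u (- p) \<in> \<Gamma>"
          using p by (intro mult u) auto
        then show ?thesis by (simp add: bruhat_u_def mat2_mult)
      qed
    qed
  qed
  then show ?thesis
    using factors_through_UNIV by (metis mat2_exhaust subsetI)
qed

end

section \<open>Linking all pairs\<close>

text \<open>Over a local ring the assumption says that the residue ring has at least four elements.\<close>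

locale large_matrix_involution = matrix_involution +
  assumes three_units: "\<exists>a b c. a \<in> unit_set \<and> b \<in> unit_set \<and> c \<in> (unit_set :: 'a set) \<and>
    a - b \<in> unit_set \<and> a - c \<in> unit_set \<and> b - c \<in> unit_set"
begin

text \<open>Take \<open>v\<close> and \<open>w\<close> with \<open>f(v)\<close> and \<open>g(w)\<close> units and suppose that no column works. Modulo the
  radical, \<open>f(w) = 0\<close> and \<open>g(v) = 0\<close>, so \<open>f(v + w a) = \<alpha> + T a\<close> with \<open>\<alpha> = f(v)\<close> and \<open>T\<close> additive, whereas
  \<open>g(v + w a) + g(v - w a) = 2 a\<^sup>* g(w) a\<close>. For a unit \<open>a\<close> the latter is a unit, so \<open>g\<close> has a unit value
  at \<open>v + w a\<close> or at \<open>v - w a\<close>, where \<open>f\<close> has to vanish: \<open>T a = \<alpha>\<close> or \<open>T a = - \<alpha>\<close>. In particular \<open>T\<close>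
  is injective modulo the radical, and it takes at most two values on the nonzero residues. Hence
  there are at most three residues.\<close>

lemma common_form_value_unit:
  assumes f: "f \<in> A.sym" "\<not> radical_mat f" and g: "g \<in> A.sym" "\<not> radical_mat g"
  obtains v where "form f v v \<in> unit_set" "form g v v \<in> unit_set"
proof (rule ccontr)
  assume no: "\<not> thesis"
  have bad: "form f x x \<notin> unit_set \<or> form g x x \<notin> unit_set" for x
    using no that by blast
  obtain v where v: "form f v v \<in> unit_set" using form_value_unit[OF f] .
  obtain w where w: "form g w w \<in> unit_set" using form_value_unit[OF g] .
  have nv: "form g v v \<notin> unit_set" and nw: "form f w w \<notin> unit_set"
    using bad v w by blast+
  define \<alpha> where "\<alpha> = form f v v"
  define T where "T a = form f v w * a + star a * form f w v" for a
  have \<alpha>: "\<alpha> \<in> unit_set" using v by (simp add: \<alpha>_def)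
  have \<alpha>2: "\<alpha> + \<alpha> \<in> unit_set"
    using unit_mult[OF two_unit \<alpha>] by (simp add: mult_2)
  define F where "F a = form f (\<lambda>i. v i + rscale w a i) (\<lambda>i. v i + rscale w a i)" for a
  define G where "G a = form g (\<lambda>i. v i + rscale w a i) (\<lambda>i. v i + rscale w a i)" for a
  have F: "F a = \<alpha> + T a + star a * form f w w * a" for a
    unfolding F_def form_shift by (simp add: \<alpha>_def T_def algebra_simps)
  have nF: "star a * form f w w * a \<notin> unit_set" for a
    by (intro nonunit_mult nw)
  have T_minus: "T (- a) = - T a" for a by (simp add: T_def)
  have dichotomy: "T a + \<alpha> \<notin> unit_set \<or> T a - \<alpha> \<notin> unit_set" if a: "a \<in> unit_set" for a
  proof (cases "F a \<in> unit_set")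
    case False
    moreover have "T a + \<alpha> = F a - star a * form f w w * a" by (simp add: F)
    ultimately show ?thesis using nonunit_diff nF by metis
  next
    case True
    then have Ga: "G a \<notin> unit_set" using bad unfolding F_def G_def by blast
    have "G a + G (- a) = 2 * (star a * form g w w * a) + (form g v v + form g v v)"
      unfolding G_def form_shift by (simp add: algebra_simps mult_2)
    moreover have "2 * (star a * form g w w * a) \<in> unit_set"
      by (intro unit_mult two_unit w) (use a in auto)
    ultimately have "G a + G (- a) \<in> unit_set"
      using unit_add_nonunit(1) nonunit_add nv by metis
    then have "G (- a) \<in> unit_set" using nonunit_add Ga by blast
    then have "F (- a) \<notin> unit_set" using bad unfolding F_def G_def by blast
    moreover have "T a - \<alpha> = star a * form f w w * a - F (- a)" by (simp add: F T_minus)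
    ultimately show ?thesis using nonunit_diff nF by metis
  qed
  have T_diff: "T (a - b) = T a - T b" for a b by (simp add: T_def algebra_simps)
  have separate: False
    if a: "a - b \<in> unit_set" and e: "T a - e \<notin> unit_set" "T b - e \<notin> unit_set" for a b e
  proof -
    have "T (a - b) = (T a - e) - (T b - e)" by (simp add: T_diff)
    then have n: "T (a - b) \<notin> unit_set" using nonunit_diff e by metis
    have "\<alpha> = (T (a - b) + \<alpha>) - T (a - b)" "\<alpha> = T (a - b) - (T (a - b) - \<alpha>)" by simp_all
    then show False using dichotomy[OF a] nonunit_diff n \<alpha> by metis
  qed
  obtain a b c where abc: "a \<in> unit_set" "b \<in> unit_set" "c \<in> (unit_set :: 'a set)"
    "a - b \<in> unit_set" "a - c \<in> unit_set" "b - c \<in> unit_set"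
    using three_units by blast
  have "T x - (- \<alpha>) \<notin> unit_set \<or> T x - \<alpha> \<notin> unit_set" if "x \<in> unit_set" for x
    using dichotomy[OF that] by simp
  from this[OF abc(1)] this[OF abc(2)] this[OF abc(3)] show False
    using separate[OF abc(4)] separate[OF abc(5)] separate[OF abc(6)] by blast
qed

text \<open>Induction on the rank of \<open>s\<close>. The step from \<open>0\<close> to the part \<open>f\<close> of rank one at \<open>v\<close> needs
  \<open>1 - r f\<close> to be a unit; by \<open>one_minus_outer_unit\<close> this amounts to the form \<open>s - s r s = s (1 - r s)\<close>
  taking a unit value at \<open>v\<close>. It does not vanish modulo the radical unless \<open>s\<close> does.\<close>

lemma linked_all:
  assumes "r \<in> A.sym" "s \<in> A.sym" "1 - r * s \<in> unit_set"
  shows "A.linked r s"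
proof -
  have "A.linked r s"
    if "r \<in> A.sym" "s \<in> A.sym" "1 - r * s \<in> unit_set" "factors_through I s" for I r s
    using finite[of I] that
  proof (induction I arbitrary: r s rule: finite_psubset_induct)
    case (psubset I)
    note r = psubset.prems(1) and s = psubset.prems(2) and u = psubset.prems(3)
    show ?case
    proof (cases "radical_mat s")
      case True
      then have "A.linked (- s) (- r)"
        using r s by (intro linked_radical) (auto simp: radical_uminus)
      from A.linked.swap[OF this] show ?thesis by simp
    next
      case False
      define g where "g = s - s * r * s"
      have g: "g \<in> A.sym" using r s by (simp add: g_def A.sym_iff mult.assoc)
      have "s = g * unit_inv (1 - r * s)"
      proof -
        have "g = s * (1 - r * s)" by (simp add: g_def right_diff_distrib mult.assoc)
        then show ?thesis using u by (simp add: mult.assoc)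
      qed
      then have "\<not> radical_mat g" using False radical_mult(1) by metis
      then obtain v where v: "form s v v \<in> unit_set" "form g v v \<in> unit_set"
        using common_form_value_unit[OF s False g] by blast
      define f where "f = rank_one_part s v"
      note f = rank_one_part[OF s v(1), folded f_def]
      obtain k where k: "k \<in> I" "factors_through (I - {k}) (s - f)"
        using rank_one_part_reduces[OF s v(1) psubset.prems(4)] unfolding f_def by blast
      let ?u = "mat_vec s v" let ?\<epsilon> = "unit_inv (form s v v)"
      have rf: "1 - r * f \<in> unit_set"
      proof -
        have "form g v v = form s v v - dot (star_vec ?u) (mat_vec r ?u)"
          unfolding g_def form_def mat_vec_simps dot_simps mat_vec_mult star_vec_mat_vec_sym[OF s] dot_vec_mat ..
        then have "1 - dot (star_vec ?u) (mat_vec r ?u) * ?\<epsilon> = form g v v * ?\<epsilon>"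
          using v(1) by (simp add: left_diff_distrib)
        then have "1 - dot (star_vec ?u) (mat_vec r (rscale ?u ?\<epsilon>)) \<in> unit_set"
          using v by (simp add: mat_vec_rscale dot_rscale)
        then show ?thesis
          unfolding f_def rank_one_part_def mult_outer one_minus_outer_unit .
      qed
      show ?thesis
      proof (rule A.linked.step[OF _ rf])
        have "- f = outer (rscale ?u (- ?\<epsilon>)) (star_vec ?u)"
          unfolding f_def rank_one_part_def by (rule sqmatI) (simp add: rscale_def)
        moreover have "starA (1 - r * f) \<in> unit_set" using rf by (simp only: A.star_unit)
        then have "1 - - f * - r \<in> unit_set" using r f(1) by (simp add: A.sym_iff)
        ultimately have "A.linked (- f) (- r)"
          using linked_rank_one[of "- ?\<epsilon>" "- r" ?u] v(1) f(2) r by simp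
        from A.linked.swap[OF this] show "A.linked r f" by simp
        have "I - {k} \<subset> I" using k(1) by blast
        then show "A.linked (unit_inv (1 - r * f) * r) (s - f)"
          using r s f(1) rf u k(2) by (intro psubset.IH A.sym_move A.move_unit) auto
      qed
    qed
  qed
  then show ?thesis using assms factors_through_UNIV by blast
qed

end

section \<open>The isomorphism\<close>

lemma bruhat_group_H_group:
  assumes star: "ring_involution star" and \<theta>: "is_bruhat_hom star \<theta>"
  shows "bruhat_group star (H_group star) (H_z star) (H_k star) (H_v star) \<theta>"
proof -
  interpret involution star by unfold_locales (rule star)
  interpret H: group "H_group star" unfolding H_group_def by (rule group_presented_group)
  have z: "H_z star \<in> carrier (H_group star)"
    and k: "t \<in> unit_set \<Longrightarrow> H_k star t \<in> carrier (H_group star)"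
    and v: "r \<in> sym \<Longrightarrow> H_v star r \<in> carrier (H_group star)" for t r
    by (auto simp: H_group_def H_z_def H_k_def H_v_def H_gens_def intro!: gen_class_closed)
  have gens: "Z \<in> H_gens star" "K t \<in> H_gens star \<longleftrightarrow> t \<in> unit_set" "V r \<in> H_gens star \<longleftrightarrow> r \<in> sym" for t r
    by (auto simp: H_gens_def)
  define f where "f = gen_class (H_gens star) (H_rels star)"
  have f: "f Z = H_z star" "f (K t) = H_k star t" "f (V r) = H_v star r" for t r
    by (simp_all add: f_def H_z_def H_k_def H_v_def)
  have rel: "word_value (H_group star) f a = word_value (H_group star) f b"
    if "(a, b) \<in> H_rels star" "a \<in> words (H_gens star)" "b \<in> words (H_gens star)" for a b
    unfolding H_group_def f_def using that by (rule presented_group_rel)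
  show ?thesis
  proof unfold_locales
    fix s t :: 'a assume a: "s \<in> unit_set" "t \<in> unit_set"
    then have "(pos_word [K s, K t], pos_word [K (s * t)]) \<in> H_rels star" unfolding H_rels_def by blast
    from rel[OF this] a show "H_k star s \<otimes>\<^bsub>H_group star\<^esub> H_k star t = H_k star (s * t)"
      by (simp add: f gens k)
  next
    fix q r :: 'a assume a: "q \<in> sym" "r \<in> sym"
    then have "(pos_word [V q, V r], pos_word [V (q + r)]) \<in> H_rels star" unfolding H_rels_def by blast
    from rel[OF this] a show "H_v star q \<otimes>\<^bsub>H_group star\<^esub> H_v star r = H_v star (q + r)"
      by (simp add: f gens v)
  next
    have "(pos_word [Z, Z], pos_word [K (- 1)]) \<in> H_rels star" unfolding H_rels_def by blast
    from rel[OF this] show "H_z star \<otimes>\<^bsub>H_group star\<^esub> H_z star = H_k star (- 1)"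
      by (simp add: f gens z k)
  next
    fix t r :: 'a assume a: "t \<in> unit_set" "r \<in> sym"
    then have "(pos_word [K t, V r], pos_word [V (t * r * star t), K t]) \<in> H_rels star"
      unfolding H_rels_def by blast
    from rel[OF this] a
    show "H_k star t \<otimes>\<^bsub>H_group star\<^esub> H_v star r = H_v star (t * r * star t) \<otimes>\<^bsub>H_group star\<^esub> H_k star t"
      by (simp add: f gens v k)
  next
    fix t :: 'a assume a: "t \<in> unit_set"
    then have "(pos_word [Z, K t], pos_word [K (unit_inv (star t)), Z]) \<in> H_rels star"
      unfolding H_rels_def by blast
    from rel[OF this] a
    show "H_z star \<otimes>\<^bsub>H_group star\<^esub> H_k star t = H_k star (unit_inv (star t)) \<otimes>\<^bsub>H_group star\<^esub> H_z star"
      by (simp add: f gens z k)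
  next
    fix t :: 'a assume a: "t \<in> unit_set" "t \<in> sym"
    then have "(pos_word [V t, Z, V (unit_inv t), Z, V t], pos_word [Z, K (- unit_inv t)]) \<in> H_rels star"
      unfolding H_rels_def by blast
    from rel[OF this] a
    show "H_v star t \<otimes>\<^bsub>H_group star\<^esub> H_z star \<otimes>\<^bsub>H_group star\<^esub> H_v star (unit_inv t) \<otimes>\<^bsub>H_group star\<^esub>
        H_z star \<otimes>\<^bsub>H_group star\<^esub> H_v star t = H_z star \<otimes>\<^bsub>H_group star\<^esub> H_k star (- unit_inv t)"
      by (simp add: f gens z k v H.m_assoc)
  qed (use z k v \<theta> in \<open>auto simp: is_bruhat_hom_def\<close>)
qed

lemma bruhat_hom_iso:
  assumes "linked_bruhat_group star (H_group star) (H_z star) (H_k star) (H_v star) \<theta>"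
    and onto: "carrier (SL_star star) \<subseteq> \<theta> ` carrier (H_group star)"
  shows "\<theta> \<in> iso (H_group star) (SL_star star)"
proof -
  interpret linked_bruhat_group star "H_group star" "H_z star" "H_k star" "H_v star" \<theta>
    by (rule assms(1))
  interpret S: group "SL_star star" by (rule group_SL_star[OF ring_involution])
  interpret hom: group_hom "H_group star" "SL_star star" \<theta>
    by unfold_locales (rule hom)
  have VKYV: "C \<in> VKYV" if C: "C \<in> carrier (H_group star)" for C
  proof (rule presented_group_induct[of C "H_gens star" "H_rels star" "\<lambda>C. C \<in> VKYV",
        folded H_group_def])
    show "C \<in> carrier (H_group star)" by (rule C)
    have "H_v star 0 \<otimes>\<^bsub>H_group star\<^esub> H_k star 1 \<otimes>\<^bsub>H_group star\<^esub> y 0 \<otimes>\<^bsub>H_group star\<^esub> H_v star 0 \<in> VKYV"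
      by (intro VKYV_I VKY_I) auto
    then show "\<one>\<^bsub>H_group star\<^esub> \<in> VKYV" by (simp add: v_zero k_one y_zero)
  next
    fix D x assume D: "D \<in> carrier (H_group star)" "D \<in> VKYV" and "x \<in> H_gens star"
    then have x: "x = Z \<or> (\<exists>t\<in>unit_set. x = K t) \<or> (\<exists>r\<in>sym. x = V r)"
      by (auto simp: H_gens_def)
    then show "D \<otimes>\<^bsub>H_group star\<^esub> gen_class (H_gens star) (H_rels star) x \<in> VKYV"
      using D by (auto simp: VKYV_z VKYV_k VKYV_v simp flip: H_z_def H_k_def H_v_def)
    have "D \<otimes>\<^bsub>H_group star\<^esub> H_z star \<otimes>\<^bsub>H_group star\<^esub> H_k star (- 1) \<in> VKYV"
      using D by (intro VKYV_k VKYV_z) auto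
    then have "D \<otimes>\<^bsub>H_group star\<^esub> inv\<^bsub>H_group star\<^esub> H_z star \<in> VKYV"
      using D by (simp add: inv_z m_assoc)
    with D x show "D \<otimes>\<^bsub>H_group star\<^esub>
        inv\<^bsub>H_group star\<^esub> gen_class (H_gens star) (H_rels star) x \<in> VKYV"
      by (auto simp: inv_k inv_v VKYV_k VKYV_v simp flip: H_z_def H_k_def H_v_def)
  qed
  show ?thesis
    unfolding hom.iso_iff using onto VKYV VKYV_kernel by simp
qed

theorem theorem4p4:
  fixes star :: "'s::ring_1 \<Rightarrow> 's"
    and starA :: "('s, 'm::finite) sqmat \<Rightarrow> ('s, 'm) sqmat"
  assumes "ring_involution star"
    and "local_ring TYPE('s)"
    and "infinite (radical_quotient :: 's set set) \<or> card (radical_quotient :: 's set set) > 3"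
    and "(2 :: 's) \<in> unit_set"
    and "starA = star_transpose star"
  shows "(\<exists>\<theta>. is_bruhat_hom starA \<theta>) \<and>
    (\<forall>\<theta>. is_bruhat_hom starA \<theta> \<longrightarrow> \<theta> \<in> iso (H_group starA) (SL_star starA))"
proof -
  interpret M: large_matrix_involution star "TYPE('m)"
  proof unfold_locales
    show "x + y \<notin> unit_set" if "x \<notin> unit_set" "y \<notin> unit_set" for x y :: 's
      by (rule local_ring_nonunit_add[OF assms(2) that])
    show "\<exists>a b c. a \<in> unit_set \<and> b \<in> unit_set \<and> c \<in> (unit_set :: 's set) \<and>
        a - b \<in> unit_set \<and> a - c \<in> unit_set \<and> b - c \<in> unit_set"
      using three_residues[OF assms(2,3)] by metis
  qed (rule assms)+
  have star: "ring_involution starA"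
    unfolding assms(5) by (rule M.A.ring_involution)
  have "\<theta> \<in> iso (H_group starA) (SL_star starA)" if \<theta>: "is_bruhat_hom starA \<theta>" for \<theta>
  proof (rule bruhat_hom_iso)
    interpret H: bruhat_group starA "H_group starA" "H_z starA" "H_k starA" "H_v starA" \<theta>
      by (rule bruhat_group_H_group[OF star \<theta>])
    show "linked_bruhat_group starA (H_group starA) (H_z starA) (H_k starA) (H_v starA) \<theta>"
      using M.linked_all M.common_unit unfolding assms(5)[symmetric] by unfold_locales auto
    have hom_mult: "g * h \<in> \<theta> ` carrier (H_group starA)"
      if "g \<in> \<theta> ` carrier (H_group starA)" "h \<in> \<theta> ` carrier (H_group starA)" for g h
      using that H.hom_mult[symmetric] H.m_closed by auto
    show "carrier (SL_star starA) \<subseteq> \<theta> ` carrier (H_group starA)"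
      unfolding assms(5)
    proof (rule M.SL_star_generated; unfold assms(5)[symmetric])
      show "bruhat_w \<in> \<theta> ` carrier (H_group starA)"
        unfolding H.hom_z[symmetric] by (intro imageI H.z_closed)
      show "bruhat_h starA t \<in> \<theta> ` carrier (H_group starA)" if "t \<in> unit_set" for t
        unfolding H.hom_k[OF that, symmetric] by (intro imageI H.k_closed that)
      show "bruhat_u r \<in> \<theta> ` carrier (H_group starA)" if "r \<in> symmetric_elements starA" for r
        unfolding H.hom_v[OF that, symmetric] by (intro imageI H.v_closed that)
    qed (rule hom_mult)
  qed
  then show ?thesis using bruhat_hom_exists[OF star] by blast
qed

end
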